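(* Let $G \leq \mathrm{Homeo}(\mathbb{S}^1)$ be a group of homeomorphisms of the circle whose action on $\mathbb{S}^1$ is minimal, proximal, and not topologically free. Let $G^+ := G \cap \mathrm{Homeo}^+(\mathbb{S}^1)$ and assume that distinct points of $\mathbb{S}^1$ have distinct stabilizers in $G^+$ (i.e. the map $z \mapsto G^+_z$ is injective on $\mathbb{S}^1$). Then for every faithful, $3$-transitive action of $G$ on a set $\Omega$, there exists a $G$-orbit $\mathcal{O} \subset \mathbb{S}^1$ such that the action of $G$ on $\Omega$ is conjugate to the action of $G$ on $\mathcal{O}$.
   Context: $\mathrm{Homeo}^+(\mathbb{S}^1)$ denotes the index-2 subgroup of orientation-preserving homeomorphisms. The action of $G$ on $\mathbb{S}^1$ is minimal if every orbit is dense; it is proximal if for all open intervals $I, J \subsetneq \mathbb{S}^1$ with $J \neq \emptyset$ there exists $g \in G$ with $g(I) \subset J$; it is topologically free if the set of fixed points of every non-trivial $g \in G$ has empty interior. An action on $\Omega$ is $k$-transitive if $G$ acts transitively on ordered $k$-tuples of distinct elements of $\Omega$. Two actions of $G$ on sets $\Omega, \Omega'$ are conjugate if there is a $G$-equivariant bijection $\Omega \to \Omega'$. *)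

theory Defs
  imports "HOL-Analysis.Analysis"
begin

abbreviation S1 :: "complex set" where "S1 \<equiv> sphere 0 1"

text \<open>Homeo(S^1): homeomorphisms of the circle, represented as maps on complex
  that are the identity off the circle (so composition and inverse are the group law).\<close>
definition Homeo_S1 :: "(complex \<Rightarrow> complex) set" where
  "Homeo_S1 = {f. (\<exists>g. homeomorphism S1 S1 f g) \<and> (\<forall>x. x \<notin> S1 \<longrightarrow> f x = x)}"

definition ccw :: "complex \<Rightarrow> complex \<Rightarrow> complex \<Rightarrow> bool" where
  "ccw a b c \<longleftrightarrow> a \<in> S1 \<and> b \<in> S1 \<and> c \<in> S1 \<and> a \<noteq> b \<and> b \<noteq> c \<and> a \<noteq> c
      \<and> Arg2pi (b / a) < Arg2pi (c / a)"

definition Homeo_plus_S1 :: "(complex \<Rightarrow> complex) set" where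
  "Homeo_plus_S1 = {f \<in> Homeo_S1. \<forall>a b c. ccw a b c \<longrightarrow> ccw (f a) (f b) (f c)}"

definition homeo_subgroup :: "(complex \<Rightarrow> complex) set \<Rightarrow> bool" where
  "homeo_subgroup G \<longleftrightarrow> G \<subseteq> Homeo_S1 \<and> id \<in> G \<and>
     (\<forall>f\<in>G. \<forall>g\<in>G. f \<circ> g \<in> G) \<and> (\<forall>f\<in>G. inv f \<in> G)"

definition orbit :: "(complex \<Rightarrow> complex) set \<Rightarrow> complex \<Rightarrow> complex set" where
  "orbit G x = (\<lambda>g. g x) ` G"

definition open_arc :: "complex \<Rightarrow> complex \<Rightarrow> complex set" where
  "open_arc a b = {z. ccw a z b}"

definition is_open_interval :: "complex set \<Rightarrow> bool" where
  "is_open_interval I \<longleftrightarrow> (\<exists>a\<in>S1. \<exists>b\<in>S1. a \<noteq> b \<and> I = open_arc a b)"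

definition minimal_action :: "(complex \<Rightarrow> complex) set \<Rightarrow> bool" where
  "minimal_action G \<longleftrightarrow> (\<forall>x\<in>S1. S1 \<subseteq> closure (orbit G x))"

definition proximal_action :: "(complex \<Rightarrow> complex) set \<Rightarrow> bool" where
  "proximal_action G \<longleftrightarrow> (\<forall>I J. is_open_interval I \<and> is_open_interval J \<and> J \<noteq> {}
      \<longrightarrow> (\<exists>g\<in>G. g ` I \<subseteq> J))"

definition topologically_free :: "(complex \<Rightarrow> complex) set \<Rightarrow> bool" where
  "topologically_free G \<longleftrightarrow> (\<forall>g\<in>G. g \<noteq> id \<longrightarrow>
      (top_of_set S1) interior_of {x \<in> S1. g x = x} = {})"

definition Gplus :: "(complex \<Rightarrow> complex) set \<Rightarrow> (complex \<Rightarrow> complex) set" where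
  "Gplus G = G \<inter> Homeo_plus_S1"

definition stab :: "(complex \<Rightarrow> complex) set \<Rightarrow> complex \<Rightarrow> (complex \<Rightarrow> complex) set" where
  "stab H z = {g \<in> H. g z = z}"

definition is_action :: "(complex \<Rightarrow> complex) set \<Rightarrow> 'b set \<Rightarrow> ((complex \<Rightarrow> complex) \<Rightarrow> 'b \<Rightarrow> 'b) \<Rightarrow> bool" where
  "is_action G \<Omega> act \<longleftrightarrow> (\<forall>g\<in>G. \<forall>w\<in>\<Omega>. act g w \<in> \<Omega>) \<and> (\<forall>w\<in>\<Omega>. act id w = w)
     \<and> (\<forall>g\<in>G. \<forall>h\<in>G. \<forall>w\<in>\<Omega>. act (g \<circ> h) w = act g (act h w))"

definition faithful_action :: "(complex \<Rightarrow> complex) set \<Rightarrow> 'b set \<Rightarrow> ((complex \<Rightarrow> complex) \<Rightarrow> 'b \<Rightarrow> 'b) \<Rightarrow> bool" where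
  "faithful_action G \<Omega> act \<longleftrightarrow> (\<forall>g\<in>G. (\<forall>w\<in>\<Omega>. act g w = w) \<longrightarrow> g = id)"

definition three_transitive :: "(complex \<Rightarrow> complex) set \<Rightarrow> 'b set \<Rightarrow> ((complex \<Rightarrow> complex) \<Rightarrow> 'b \<Rightarrow> 'b) \<Rightarrow> bool" where
  "three_transitive G \<Omega> act \<longleftrightarrow> (\<forall>x1\<in>\<Omega>. \<forall>x2\<in>\<Omega>. \<forall>x3\<in>\<Omega>. \<forall>y1\<in>\<Omega>. \<forall>y2\<in>\<Omega>. \<forall>y3\<in>\<Omega>.
      x1 \<noteq> x2 \<and> x1 \<noteq> x3 \<and> x2 \<noteq> x3 \<and> y1 \<noteq> y2 \<and> y1 \<noteq> y3 \<and> y2 \<noteq> y3 \<longrightarrow>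
      (\<exists>g\<in>G. act g x1 = y1 \<and> act g x2 = y2 \<and> act g x3 = y3))"

definition conjugate_to_circle_set :: "(complex \<Rightarrow> complex) set \<Rightarrow> 'b set \<Rightarrow> ((complex \<Rightarrow> complex) \<Rightarrow> 'b \<Rightarrow> 'b) \<Rightarrow> complex set \<Rightarrow> bool" where
  "conjugate_to_circle_set G \<Omega> act Orb \<longleftrightarrow> (\<exists>\<phi>. bij_betw \<phi> \<Omega> Orb \<and>
      (\<forall>g\<in>G. \<forall>w\<in>\<Omega>. \<phi> (act g w) = g (\<phi> w)))"

end

theory Submission
  imports Defs
begin

text \<open>Let \<open>H\<close> be the stabilizer of a point \<open>w\<close> of \<open>\<Omega>\<close>. If \<open>H\<close> preserves a proper nonempty closed
  subset of the circle, then 3-transitivity forces that set to be a single point \<open>z\<close>: the translates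
  of a set with two points form triples that are separated in different ways. In this case \<open>H\<close> is the
  stabilizer of \<open>z\<close>. Otherwise \<open>H\<close> acts minimally on the circle, and this is contradictory. First,
  \<open>H\<close> must meet the rigid stabilizer of every arc nontrivially, hence \<open>H\<close> squeezes every proper arc
  into every open set. Next, an ultrametric argument on triples shows that any two point stabilizers
  contain the same elements supported in sufficiently small arcs, so for every pair of points there
  is a bound on the number of disjoint arcs on which their stabilizers differ. On the other hand, if
  one arc distinguishes \<open>w\<close> from \<open>c w\<close> with \<open>c\<close> of small support, then products of conjugates of \<open>c\<close>
  by elements of \<open>H\<close> violate this bound. If there is no such arc, \<open>H\<close> meets rigid stabilizers in
  normal subgroups and, by the double commutator trick, contains a nontrivial normal subgroup
  of \<open>G\<close>.\<close>

section \<open>Arcs of the circle\<close>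

text \<open>\<open>\<Omega>\<close> carries no topology, so three-transitivity is the only leverage
  on it: a \<open>G\<close>-invariant property of ordered triples that holds for one triple of
  distinct points holds for all, in every order. It is therefore enough to exhibit one triple with
  computable geometry, such as \<open>w0\<close>, \<open>c1 w0\<close>, \<open>c2 w0\<close> with
  \<open>c1\<close>, \<open>c2\<close> supported in disjoint arcs. The obstacle is that proximality
  and elements of small support are given for \<open>G\<close> only, and conjugating by
  \<open>G\<close> moves \<open>w0\<close>. Once both are regained inside \<open>H\<close>, an
  element can be carried into any arc without moving \<open>w0\<close>. The word ultrametric refers
  to this: for a fixed set, agreement of two point stabilizers is an equivalence relation, so if two
  points disagree, one of them disagrees with any given third.\<close>

abbreviation open_S1 :: "complex set \<Rightarrow> bool" where
  "open_S1 \<equiv> openin (top_of_set S1)"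

text \<open>Angles are real numbers, so an arc across angle 0 needs no special treatment and cyclic
  order becomes the order of lifts. The parameters behave as endpoints only for
  \<open>b \<le> a + 2 * pi\<close>; at equality the arc is the circle minus one point.\<close>

definition carc :: "real \<Rightarrow> real \<Rightarrow> complex set" where
  "carc a b = cis ` {a<..<b}"

lemma cis_in_S1 [simp]: "cis t \<in> S1"
  by simp

lemma carc_subset_S1: "carc a b \<subseteq> S1"
  by (auto simp: carc_def)

lemma carc_mono: "a' \<le> a \<Longrightarrow> b \<le> b' \<Longrightarrow> carc a b \<subseteq> carc a' b'"
  by (auto simp: carc_def)

lemma cis_eq_imp_eq:
  assumes "cis s = cis t" "\<bar>s - t\<bar> < 2 * pi"
  shows "s = t"
proof -
  have "cos (s - t) = 1"
    using arg_cong[OF assms(1), of "\<lambda>z. Re (z / cis t)"] by (simp add: cis_divide)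
  then obtain n :: int where n: "s - t = of_int n * 2 * pi"
    unfolding cos_one_2pi_int by blast
  have "\<bar>real_of_int n\<bar> < 1"
    using assms(2) n by (simp add: abs_mult)
  then have "n = 0" by linarith
  with n show ?thesis by simp
qed

lemma cis_minus_2pi [simp]: "cis (t - 2 * pi) = cis t"
  by (simp add: complex_eq_iff cos_diff sin_diff)

lemma cis_plus_2pi [simp]: "cis (t + 2 * pi) = cis t"
  by (simp add: complex_eq_iff)

lemma S1_cis_cases:
  assumes "z \<in> S1"
  obtains t where "c \<le> t" "t < c + 2 * pi" "z = cis t"
proof -
  have *: "norm (z / cis c) = 1" using assms by (simp add: norm_divide)
  define t where "t = c + Arg2pi (z / cis c)"
  have "z / cis c = cis (Arg2pi (z / cis c))"
    using Arg2pi_eq[of "z / cis c"] * by (simp add: cis_conv_exp)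
  then have "z = cis t"
    by (simp add: t_def divide_eq_eq flip: cis_mult) (simp add: mult.commute)
  moreover have "c \<le> t" "t < c + 2 * pi"
    using Arg2pi_ge_0[of "z / cis c"] Arg2pi_lt_2pi[of "z / cis c"] by (auto simp: t_def)
  ultimately show ?thesis using that by blast
qed

lemma S1_branch:
  obtains \<psi> where "continuous_on (S1 - {cis c}) \<psi>"
    "\<And>z. z \<in> S1 - {cis c} \<Longrightarrow> \<psi> z \<in> {c<..<c + 2 * pi} \<and> cis (\<psi> z) = z"
    "\<And>t. t \<in> {c<..<c + 2 * pi} \<Longrightarrow> \<psi> (cis t) = t"
proof -
  \<comment> \<open>Rotation by \<open>m\<close> sends \<open>cis c\<close> to -1, onto the cut of
    \<open>Arg\<close>.\<close>
  define m where "m = cis (- (c + pi))"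
  define \<psi> where "\<psi> z = c + pi + Arg (z * m)" for z
  have inv1: "\<psi> (cis t) = t" if "t \<in> {c<..<c + 2 * pi}" for t
    using that by (simp add: \<psi>_def m_def cis_mult Arg_cis)
  have inv2: "\<psi> z \<in> {c<..<c + 2 * pi} \<and> cis (\<psi> z) = z" if z: "z \<in> S1 - {cis c}" for z
  proof -
    obtain t where t: "c \<le> t" "t < c + 2 * pi" "z = cis t"
      using S1_cis_cases[of z c] z by blast
    with z have "t \<noteq> c" by auto
    with t inv1[of t] show ?thesis by simp
  qed
  have "continuous_on (S1 - {cis c}) \<psi>"
    unfolding \<psi>_def
  proof (intro continuous_intros)
    fix z assume z: "z \<in> S1 - {cis c}"
    show "z * m \<notin> \<real>\<^sub>\<le>\<^sub>0"
    proof
      assume "z * m \<in> \<real>\<^sub>\<le>\<^sub>0"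
      then obtain r where r: "z * m = complex_of_real r" "r \<le> 0"
        by (auto elim: nonpos_Reals_cases)
      have "norm (z * m) = 1" using z by (simp add: norm_mult m_def)
      then have "\<bar>r\<bar> = 1" using r by simp
      then have "z * m = -1" using r by auto
      then have "Arg (z * m) = pi" by (simp add: Arg_eq_pi)
      then have "\<psi> z = c + 2 * pi" by (simp add: \<psi>_def)
      with inv2[OF z] show False by auto
    qed
  qed
  with inv1 inv2 that show ?thesis by blast
qed

lemma connected_carc: "connected (carc a b)"
  unfolding carc_def by (intro connected_continuous_image continuous_on_cis) auto

lemma open_carc:
  assumes "b \<le> a + 2 * pi"
  shows "open_S1 (carc a b)"
proof -
  obtain \<psi> where \<psi>: "continuous_on (S1 - {cis a}) \<psi>"
    "\<And>z. z \<in> S1 - {cis a} \<Longrightarrow> \<psi> z \<in> {a<..<a + 2 * pi} \<and> cis (\<psi> z) = z"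
    "\<And>t. t \<in> {a<..<a + 2 * pi} \<Longrightarrow> \<psi> (cis t) = t"
    using S1_branch by blast
  have "carc a b = (S1 - {cis a}) \<inter> \<psi> -` {a<..<b}" (is "_ = ?R")
  proof (intro set_eqI iffI)
    fix z assume "z \<in> carc a b"
    then obtain t where t: "z = cis t" "a < t" "t < b" by (auto simp: carc_def)
    then have "z \<noteq> cis a" using cis_eq_imp_eq[of t a] assms by force
    with t assms \<psi>(3)[of t] show "z \<in> ?R" by auto
  next
    fix z assume "z \<in> ?R"
    then show "z \<in> carc a b"
      using \<psi>(2)[of z] by (auto simp: carc_def image_iff intro!: bexI[of _ "\<psi> z"])
  qed
  moreover have "openin (top_of_set (S1 - {cis a})) ((S1 - {cis a}) \<inter> \<psi> -` {a<..<b})"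
    using \<psi>(1) by (intro continuous_openin_preimage_gen) auto
  moreover have "open_S1 (S1 - {cis a})"
    by (intro openin_delete) auto
  ultimately show ?thesis using openin_trans by metis
qed

lemma carc_disjoint:
  assumes "b \<le> c" "d \<le> a + 2 * pi"
  shows "carc a b \<inter> carc c d = {}"
proof -
  have False if "cis s = cis t" "a < s" "s < b" "c < t" "t < d" for s t
    using cis_eq_imp_eq[OF that(1)] that assms by (simp add: abs_if split: if_splits)
  then show ?thesis by (force simp: carc_def)
qed

lemma cis_notin_carc:
  assumes "t \<le> a" "b \<le> t + 2 * pi"
  shows "cis t \<notin> carc a b"
proof
  assume "cis t \<in> carc a b"
  then obtain s where s: "cis s = cis t" "a < s" "s < b" by (auto simp: carc_def)
  with cis_eq_imp_eq[OF s(1)] assms show False by (simp add: abs_if split: if_splits)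
qed

text \<open>With the circle cut at \<open>cis a\<close>, the angles of \<open>U\<close> form an
  interval that omits \<open>b\<close>.\<close>

lemma connected_in_carc:
  assumes "connected U" "U \<subseteq> S1" "cis a \<notin> U" "cis b \<notin> U" "a < b" "b < a + 2 * pi"
  shows "U \<subseteq> carc a b \<or> U \<subseteq> carc b (a + 2 * pi)"
proof -
  obtain \<psi> where \<psi>: "continuous_on (S1 - {cis a}) \<psi>"
    "\<And>z. z \<in> S1 - {cis a} \<Longrightarrow> \<psi> z \<in> {a<..<a + 2 * pi} \<and> cis (\<psi> z) = z"
    "\<And>t. t \<in> {a<..<a + 2 * pi} \<Longrightarrow> \<psi> (cis t) = t"
    using S1_branch by blast
  have sub: "U \<subseteq> S1 - {cis a}" using assms by auto
  have con: "connected (\<psi> ` U)"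
    using assms(1) continuous_on_subset[OF \<psi>(1) sub] by (rule connected_continuous_image[rotated])
  have *: "z = cis (\<psi> z) \<and> a < \<psi> z \<and> \<psi> z < a + 2 * pi \<and> \<psi> z \<in> \<psi> ` U" if "z \<in> U" for z
    using that \<psi>(2)[OF subsetD[OF sub that]] by (metis greaterThanLessThan_iff imageI)
  have b: "b \<notin> \<psi> ` U" using \<psi>(2) sub assms(4) by force
  have "\<psi> ` U \<subseteq> {..<b} \<or> \<psi> ` U \<subseteq> {b<..}"
  proof (rule ccontr)
    assume "\<not> ?thesis"
    then obtain x y where "x \<in> \<psi> ` U" "y \<in> \<psi> ` U" "x \<ge> b" "y \<le> b" by (meson greaterThan_iff lessThan_iff not_less subsetI)
    with con b show False
      by (meson connected_contains_Icc[OF con] atLeastAtMost_iff subsetD)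
  qed
  then show ?thesis
  proof
    assume "\<psi> ` U \<subseteq> {..<b}"
    then have "z \<in> carc a b" if "z \<in> U" for z
      using *[OF that] by (force simp: carc_def)
    then show ?thesis by blast
  next
    assume "\<psi> ` U \<subseteq> {b<..}"
    then have "z \<in> carc b (a + 2 * pi)" if "z \<in> U" for z
      using *[OF that] by (force simp: carc_def)
    then show ?thesis by blast
  qed
qed

lemma carc_nbhd:
  assumes "open_S1 V" "cis t \<in> V" "e > 0"
  obtains d where "0 < d" "d < e" "carc (t - d) (t + d) \<subseteq> V"
proof -
  obtain T where T: "open T" "V = S1 \<inter> T" using assms(1) by (auto simp: openin_open)
  have "open (cis -` T)" using T(1) by (rule open_vimage) (intro continuous_intros)
  moreover have "t \<in> cis -` T" using T assms(2) by auto
  ultimately obtain r where r: "r > 0" "ball t r \<subseteq> cis -` T" by (meson open_contains_ball)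
  define d where "d = min r (e/2)"
  have "carc (t - d) (t + d) \<subseteq> V"
  proof
    fix z assume "z \<in> carc (t - d) (t + d)"
    then obtain u where u: "z = cis u" "t - d < u" "u < t + d" by (auto simp: carc_def)
    then have "u \<in> ball t r" by (auto simp: d_def dist_real_def)
    with r T u show "z \<in> V" by auto
  qed
  moreover have "0 < d" "d < e" using r assms(3) by (auto simp: d_def min_def)
  ultimately show ?thesis using that by blast
qed

lemma carc_inside:
  assumes "open_S1 V" "V \<noteq> {}" "e > 0"
  obtains a b where "a < b" "b < a + e" "carc a b \<subseteq> V"
proof -
  obtain z where z: "z \<in> V" using assms by blast
  then have "z \<in> S1" using assms openin_imp_subset by blast
  then obtain t where t: "z = cis t" using S1_cis_cases by metis
  obtain d where "0 < d" "d < e/2" "carc (t - d) (t + d) \<subseteq> V"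
    using carc_nbhd[OF assms(1), of t "e/2"] z t assms(3) by auto
  then show ?thesis using that[of "t - d" "t + d"] by (auto simp: field_simps)
qed

lemma carc_nonempty: "a < b \<Longrightarrow> carc a b \<noteq> {}"
  by (auto simp: carc_def)

lemma is_open_interval_carc:
  assumes "a < b" "b < a + 2 * pi"
  shows "is_open_interval (carc a b)"
proof -
  have ne: "cis a \<noteq> cis b" using cis_eq_imp_eq[of a b] assms by auto
  have A: "Arg2pi (cis (u - a)) = u - a" if "a \<le> u" "u < a + 2 * pi" for u
    using that by (intro Arg2pi_unique[of 1]) (auto simp: cis_conv_exp)
  have "carc a b = open_arc (cis a) (cis b)"
  proof (intro set_eqI iffI)
    fix z assume "z \<in> carc a b"
    then obtain t where t: "z = cis t" "a < t" "t < b" by (auto simp: carc_def)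
    have "cis t \<noteq> cis a" "cis t \<noteq> cis b"
      using cis_eq_imp_eq[of t a] cis_eq_imp_eq[of t b] t assms by auto
    with t ne assms A[of t] A[of b] show "z \<in> open_arc (cis a) (cis b)"
      by (auto simp: open_arc_def ccw_def cis_divide)
  next
    fix z assume "z \<in> open_arc (cis a) (cis b)"
    then have z: "z \<in> S1" "z \<noteq> cis a" "Arg2pi (z / cis a) < Arg2pi (cis b / cis a)"
      by (auto simp: open_arc_def ccw_def)
    obtain t where t: "a \<le> t" "t < a + 2 * pi" "z = cis t"
      using S1_cis_cases[of z a] z(1) by blast
    have "t \<noteq> a" using t z by auto
    moreover have "t < b" using z t A[of t] A[of b] assms by (auto simp: cis_divide)
    ultimately show "z \<in> carc a b" using t by (auto simp: carc_def)
  qed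
  then show ?thesis using ne unfolding is_open_interval_def by (metis cis_in_S1)
qed

text \<open>Non-density is asked rather than being an arc: complements of nonempty open sets and
  images of such sets then qualify directly, and \<open>narrow_in_carc\<close> supplies an enclosing
  arc.\<close>

definition narrow :: "complex set \<Rightarrow> bool" where
  "narrow K \<longleftrightarrow> K \<subseteq> S1 \<and> (\<exists>V. open_S1 V \<and> V \<noteq> {} \<and> V \<inter> K = {})"

lemma narrow_subset: "narrow K \<Longrightarrow> L \<subseteq> K \<Longrightarrow> narrow L"
  unfolding narrow_def by blast

lemma narrow_in_carc:
  assumes "narrow K"
  obtains a b where "a < b" "b < a + 2 * pi" "K \<subseteq> carc a b"
proof -
  obtain V where V: "K \<subseteq> S1" "open_S1 V" "V \<noteq> {}" "V \<inter> K = {}"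
    using assms by (auto simp: narrow_def)
  obtain p q where pq: "p < q" "q < p + 2 * pi" "carc p q \<subseteq> V"
    using carc_inside[OF V(2,3), of "2*pi"] by auto
  \<comment> \<open>The gap \<open>(p, q)\<close> is shrunk by a third at each end, so that the
    enclosing open arc covers the closed complement and still misses an interval.\<close>
  define d where "d = (q - p) / 3"
  have d: "d > 0" "q = p + 3 * d" using pq by (auto simp: d_def field_simps)
  have "K \<subseteq> carc (q - d) (p + d + 2 * pi)"
  proof
    fix z assume z: "z \<in> K"
    then obtain t where t: "q - d \<le> t" "t < q - d + 2 * pi" "z = cis t"
      using S1_cis_cases[of z "q - d"] V(1) by blast
    have "cis t \<notin> carc p q" using z t V pq by auto
    then have 1: "\<not> (p < t \<and> t < q)" and 2: "\<not> (p < t - 2 * pi \<and> t - 2 * pi < q)"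
      unfolding carc_def by (metis cis_minus_2pi greaterThanLessThan_iff imageI)+
    show "z \<in> carc (q - d) (p + d + 2 * pi)"
      using t d 1 2 by (auto simp: carc_def)
  qed
  moreover have "q - d < p + d + 2 * pi" "p + d + 2 * pi < q - d + 2 * pi" using d pq by auto
  ultimately show ?thesis using that by blast
qed

lemma narrow_carc:
  assumes "b < a + 2 * pi"
  shows "narrow (carc a b)"
proof (cases "a < b")
  case True
  have "carc b (a + 2 * pi) \<inter> carc a b = {}"
    using carc_disjoint[of b b "a + 2*pi" a] by blast
  moreover have "open_S1 (carc b (a + 2 * pi))" by (intro open_carc) (use True in auto)
  moreover have "carc b (a + 2 * pi) \<noteq> {}" using assms by (intro carc_nonempty)
  ultimately show ?thesis unfolding narrow_def using carc_subset_S1 by blast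
next
  case False
  then have "carc a b = {}" by (auto simp: carc_def)
  moreover have "open_S1 S1" "S1 \<noteq> {}" by auto
  ultimately show ?thesis unfolding narrow_def by blast
qed

lemma distinct_S1_cis:
  assumes "x \<in> S1" "y \<in> S1" "x \<noteq> y"
  obtains a b where "x = cis a" "y = cis b" "a < b" "b < a + 2 * pi"
proof -
  obtain a where a: "x = cis a" using S1_cis_cases[OF assms(1)] by metis
  obtain b where b: "a \<le> b" "b < a + 2 * pi" "y = cis b" using S1_cis_cases[OF assms(2)] by metis
  with a assms(3) have "a \<noteq> b" by auto
  with a b that show ?thesis by force
qed

lemma connected_S1: "connected S1"
  by (simp add: connected_sphere_eq)

lemma infinite_S1: "infinite S1"
proof -
  have "inj_on cis {0<..<1}"
    by (intro inj_onI cis_eq_imp_eq) (use pi_gt3 in auto)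
  moreover have "infinite {0<..<1::real}"
    by (rule infinite_Ioo) simp
  ultimately have "infinite (carc 0 1)"
    unfolding carc_def using finite_imageD by blast
  then show ?thesis using carc_subset_S1 finite_subset by blast
qed

lemma closed_connected_proper_S1:
  assumes "closed A" "connected A" "A \<subseteq> S1" "c \<in> S1 - A" "A \<noteq> {}" "c = cis t"
  obtains x y where "t < x" "x \<le> y" "y < t + 2 * pi" "A = cis ` {x..y}"
proof -
  obtain \<psi> where \<psi>: "continuous_on (S1 - {cis t}) \<psi>"
    "\<And>z. z \<in> S1 - {cis t} \<Longrightarrow> \<psi> z \<in> {t<..<t + 2 * pi} \<and> cis (\<psi> z) = z"
    "\<And>u. u \<in> {t<..<t + 2 * pi} \<Longrightarrow> \<psi> (cis u) = u"
    using S1_branch by blast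
  have sub: "A \<subseteq> S1 - {cis t}" using assms by auto
  have comp: "compact A" using assms(1,3) compact_sphere by (metis compact_Int_closed inf.absorb2)
  have cont: "continuous_on A \<psi>" using continuous_on_subset[OF \<psi>(1) sub] .
  have "compact (\<psi> ` A)" "connected (\<psi> ` A)"
    using comp cont assms(2) compact_continuous_image connected_continuous_image by auto
  then obtain x y where xy: "\<psi> ` A = {x..y}" using connected_compact_interval_1 by metis
  have "x \<le> y" using xy assms(5) by (metis atLeastatMost_empty_iff image_is_empty)
  then have "x \<in> \<psi> ` A" "y \<in> \<psi> ` A" unfolding xy by auto
  have *: "t < \<psi> z \<and> \<psi> z < t + 2 * pi \<and> cis (\<psi> z) = z" if "z \<in> A" for z
    using that \<psi>(2)[OF subsetD[OF sub that]] by (metis greaterThanLessThan_iff)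
  have "t < x" "y < t + 2 * pi"
    using * \<open>x \<in> \<psi> ` A\<close> \<open>y \<in> \<psi> ` A\<close> by blast+
  moreover have "cis ` \<psi> ` A = (\<lambda>z. z) ` A"
    unfolding image_image using * by (intro image_cong) auto
  then have "A = cis ` {x..y}" unfolding xy by simp
  ultimately show ?thesis using \<open>x \<le> y\<close> by (intro that)
qed

section \<open>Groups of circle homeomorphisms\<close>

text \<open>Kept apart from the dynamical hypotheses because it is also interpreted for
  \<open>pstab w0\<close>, where only the group structure is known at first.\<close>

locale homeo_group =
  fixes G :: "(complex \<Rightarrow> complex) set"
  assumes homeo_subgroup: "homeo_subgroup G"
begin

lemma id_mem [simp]: "id \<in> G"
  and comp_mem [simp]: "f \<in> G \<Longrightarrow> g \<in> G \<Longrightarrow> f \<circ> g \<in> G"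
  and inv_mem [simp]: "f \<in> G \<Longrightarrow> inv f \<in> G"
  using homeo_subgroup by (auto simp: homeo_subgroup_def)

lemma homeo:
  assumes "g \<in> G"
  obtains g' where "homeomorphism S1 S1 g g'" "\<And>x. x \<notin> S1 \<Longrightarrow> g x = x"
  using assms homeo_subgroup unfolding homeo_subgroup_def Homeo_S1_def by blast

lemma mem_S1_iff: "g \<in> G \<Longrightarrow> g x \<in> S1 \<longleftrightarrow> x \<in> S1"
  by (erule homeo[of g]) (metis homeomorphism_image1 image_eqI)

text \<open>Being the identity off the circle makes \<open>g\<close> a bijection of the whole plane,
  so that the total function \<open>inv g\<close> is a genuine inverse.\<close>

lemma bij_G: assumes "g \<in> G" shows "bij g"
proof -
  obtain g' where g': "homeomorphism S1 S1 g g'" "\<And>x. x \<notin> S1 \<Longrightarrow> g x = x"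
    using homeo[OF assms] by blast
  show ?thesis
  proof (rule bijI)
    show "inj g"
      by (rule injI) (metis assms g' homeomorphism_apply1 mem_S1_iff)
    show "surj g"
    proof (rule surjI)
      fix x show "g (if x \<in> S1 then g' x else x) = x"
        using g' homeomorphism_apply2[OF g'(1), of x] by auto
    qed
  qed
qed

lemma inv_apply [simp]: "g \<in> G \<Longrightarrow> inv g (g x) = x"
  and apply_inv [simp]: "g \<in> G \<Longrightarrow> g (inv g x) = x"
  using bij_G by (auto simp: bij_is_inj bij_is_surj surj_f_inv_f)

lemma inj_G: "g \<in> G \<Longrightarrow> g x = g y \<longleftrightarrow> x = y"
  by (metis inv_apply)

lemma inv_comp [simp]: "g \<in> G \<Longrightarrow> inv g \<circ> g = id"
  and comp_inv [simp]: "g \<in> G \<Longrightarrow> g \<circ> inv g = id"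
  by (auto simp: fun_eq_iff)

lemma mem_image_iff: "g \<in> G \<Longrightarrow> g x \<in> g ` U \<longleftrightarrow> x \<in> U"
  by (auto simp: inj_G)

lemma mem_image_inv: "g \<in> G \<Longrightarrow> x \<in> g ` U \<longleftrightarrow> inv g x \<in> U"
  by (metis apply_inv mem_image_iff)

lemma image_Int_G: "g \<in> G \<Longrightarrow> g ` (U \<inter> V) = g ` U \<inter> g ` V"
  by (auto simp: inj_G)

lemma image_inv_image [simp]: "g \<in> G \<Longrightarrow> inv g ` g ` U = U"
  and image_image_inv [simp]: "g \<in> G \<Longrightarrow> g ` inv g ` U = U"
  by (auto simp: image_image)

lemma image_subset_S1: "g \<in> G \<Longrightarrow> U \<subseteq> S1 \<Longrightarrow> g ` U \<subseteq> S1"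
  using mem_S1_iff by blast

lemma continuous_on_G: "g \<in> G \<Longrightarrow> continuous_on S1 g"
  by (erule homeo) (auto simp: homeomorphism_def)

lemma open_image: "g \<in> G \<Longrightarrow> open_S1 U \<Longrightarrow> open_S1 (g ` U)"
  using homeo homeomorphism_imp_open_map by metis

lemma connected_image: "g \<in> G \<Longrightarrow> U \<subseteq> S1 \<Longrightarrow> connected U \<Longrightarrow> connected (g ` U)"
  using continuous_on_G connected_continuous_image continuous_on_subset by metis

lemma closed_image: assumes "g \<in> G" "U \<subseteq> S1" "closed U" shows "closed (g ` U)"
proof -
  have "compact (S1 \<inter> U)" using assms(3) by (intro compact_Int_closed) auto
  then have "compact U" using assms(2) by (simp add: inf.absorb2)
  then show ?thesis
    using assms continuous_on_G compact_continuous_image continuous_on_subset compact_imp_closed by metis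
qed

lemma narrow_image:
  assumes "g \<in> G" "narrow K" shows "narrow (g ` K)"
proof -
  obtain V where "K \<subseteq> S1" "open_S1 V" "V \<noteq> {}" "V \<inter> K = {}" using assms(2) by (auto simp: narrow_def)
  then have "g ` K \<subseteq> S1" "open_S1 (g ` V)" "g ` V \<noteq> {}" "g ` V \<inter> g ` K = {}"
    using assms(1) image_subset_S1 open_image image_Int_G[of g V K] by auto
  then show ?thesis unfolding narrow_def by blast
qed

text \<open>The rigid stabilizer of \<^term>\<open>U\<close>.\<close>
definition rist :: "complex set \<Rightarrow> (complex \<Rightarrow> complex) set" where
  "rist U = {g \<in> G. \<forall>x. x \<notin> U \<longrightarrow> g x = x}"

lemma rist_G: "g \<in> rist U \<Longrightarrow> g \<in> G"
  by (simp add: rist_def)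

lemma rist_fix: "g \<in> rist U \<Longrightarrow> x \<notin> U \<Longrightarrow> g x = x"
  by (simp add: rist_def)

lemma rist_mono: "g \<in> rist U \<Longrightarrow> U \<subseteq> V \<Longrightarrow> g \<in> rist V"
  by (auto simp: rist_def)

lemma rist_id [simp]: "id \<in> rist U"
  by (simp add: rist_def)

lemma rist_comp: "f \<in> rist U \<Longrightarrow> g \<in> rist U \<Longrightarrow> f \<circ> g \<in> rist U"
  by (simp add: rist_def)

lemma rist_inv: assumes "f \<in> rist U" shows "inv f \<in> rist U"
proof -
  have f: "f \<in> G" using assms by (rule rist_G)
  have "inv f x = x" if "x \<notin> U" for x
    using inv_apply[OF f, of x] rist_fix[OF assms that] by simp
  then show ?thesis using f by (simp add: rist_def)
qed

lemma rist_mem_iff: "f \<in> rist U \<Longrightarrow> f x \<in> U \<longleftrightarrow> x \<in> U"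
  using inj_G[OF rist_G, of f U "f x" x] rist_fix[of f U x] rist_fix[of f U "f x"] by auto

lemma rist_image: assumes "f \<in> rist U" "U \<subseteq> V \<or> U \<inter> V = {}" shows "f ` V = V"
proof -
  have *: "g ` V \<subseteq> V" if "g \<in> rist U" for g
    using assms(2) rist_mem_iff[OF that] rist_fix[OF that]
    by (metis disjoint_iff image_subsetI subsetD)
  have "V = f ` inv f ` V" using rist_G[OF assms(1)] by simp
  also have "\<dots> \<subseteq> f ` V" using *[OF rist_inv[OF assms(1)]] by blast
  finally show ?thesis using *[OF assms(1)] by blast
qed

lemma rist_conj: "g \<in> G \<Longrightarrow> s \<in> rist U \<Longrightarrow> g \<circ> s \<circ> inv g \<in> rist (g ` U)"
  by (auto simp: rist_def mem_image_inv)

lemma rist_commute: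
  assumes "a \<in> rist U" "b \<in> rist V" "U \<inter> V = {}" shows "a \<circ> b = b \<circ> a"
proof
  fix x show "(a \<circ> b) x = (b \<circ> a) x"
    using assms rist_fix rist_mem_iff by (metis comp_apply disjoint_iff)
qed

lemma moved_open:
  assumes "g \<in> G" shows "open_S1 {x \<in> S1. g x \<noteq> x}"
proof -
  have "continuous_on S1 (\<lambda>x. g x - x)"
    using continuous_on_G[OF assms] by (intro continuous_intros)
  then have "open_S1 (S1 \<inter> (\<lambda>x. g x - x) -` (- {0}))"
    by (intro continuous_openin_preimage_gen) auto
  moreover have "S1 \<inter> (\<lambda>x. g x - x) -` (- {0}) = {x \<in> S1. g x \<noteq> x}" by auto
  ultimately show ?thesis by simp
qed

lemma nontrivial_moves:
  assumes "g \<in> G" "g \<noteq> id"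
  obtains x where "x \<in> S1" "g x \<noteq> x"
proof -
  obtain x where x: "g x \<noteq> x" using assms(2) by (auto simp: fun_eq_iff)
  then have "x \<in> S1" using homeo[OF assms(1)] by metis
  with x that show ?thesis by blast
qed

lemma displaced_nbhd:
  assumes "g \<in> G" "g x \<noteq> x" "x \<in> V" "open_S1 V"
  obtains W where "open_S1 W" "x \<in> W" "W \<subseteq> V" "g ` W \<inter> W = {}"
proof -
  obtain A B where AB: "open A" "open B" "g x \<in> A" "x \<in> B" "A \<inter> B = {}"
    using hausdorff[OF assms(2)] by blast
  define W where "W = V \<inter> (S1 \<inter> B \<inter> (S1 \<inter> g -` A))"
  have "open_S1 (S1 \<inter> g -` A)"
    using continuous_on_G[OF assms(1)] AB by (intro continuous_openin_preimage_gen)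
  moreover have "open_S1 (S1 \<inter> B)" using AB by (auto simp: openin_open)
  ultimately have "open_S1 W" unfolding W_def using assms(4) openin_Int by metis
  moreover have "x \<in> S1" using assms openin_imp_subset by blast
  then have "x \<in> W" using AB assms by (simp add: W_def)
  moreover have "W \<subseteq> V" "g ` W \<inter> W = {}" using AB by (auto simp: W_def)
  ultimately show ?thesis using that by blast
qed

text \<open>Zorn's lemma applies because failing to fit into \<open>V0\<close> passes to
  intersections of chains: if \<open>h\<close> maps the intersection into the open set
  \<open>V0\<close>, compactness gives a member already mapped into \<open>V0\<close>.\<close>

lemma minimal_rigid:
  assumes "closed C0" "connected C0" "C0 \<subseteq> S1" "\<forall>h\<in>G. \<not> h ` C0 \<subseteq> V0" and V0: "open_S1 V0" "V0 \<noteq> {}"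
  obtains A where "closed A" "connected A" "A \<subseteq> C0" "\<forall>h\<in>G. \<not> h ` A \<subseteq> V0"
    "\<And>C. closed C \<Longrightarrow> connected C \<Longrightarrow> C \<subseteq> A \<Longrightarrow> \<forall>h\<in>G. \<not> h ` C \<subseteq> V0 \<Longrightarrow> C = A"
proof -
  define \<N> where "\<N> = {C. closed C \<and> connected C \<and> C \<subseteq> C0 \<and> (\<forall>h\<in>G. \<not> h ` C \<subseteq> V0)}"
  have comp: "compact C" if "C \<in> \<N>" for C
  proof -
    have "compact (S1 \<inter> C)" using that by (intro compact_Int_closed) (auto simp: \<N>_def)
    moreover have "S1 \<inter> C = C" using that assms(3) by (auto simp: \<N>_def)
    ultimately show ?thesis by simp
  qed
  have Inter: "\<Inter>\<F> \<in> \<N>"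
    if \<F>: "\<F> \<noteq> {}" "\<F> \<subseteq> \<N>" and lin: "\<And>S T. S \<in> \<F> \<and> T \<in> \<F> \<Longrightarrow> S \<subseteq> T \<or> T \<subseteq> S" for \<F>
  proof -
    have cc: "compact S \<and> connected S" if "S \<in> \<F>" for S
      using comp that \<F>(2) by (auto simp: \<N>_def)
    have "connected (\<Inter>\<F>)" by (rule connected_chain[OF cc lin])
    moreover have "closed (\<Inter>\<F>)" using cc compact_imp_closed by (intro closed_Inter) blast
    moreover have sub: "\<Inter>\<F> \<subseteq> C0" using \<F> by (auto simp: \<N>_def)
    moreover have "\<not> h ` \<Inter>\<F> \<subseteq> V0" if h: "h \<in> G" for h
    proof
      assume hV: "h ` \<Inter>\<F> \<subseteq> V0"
      define P where "P = S1 \<inter> h -` (S1 - V0)"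
      have "closedin (top_of_set S1) (S1 - V0)"
        using V0(1) by (intro closedin_diff) (simp_all add: closed_subset)
      then have "closedin (top_of_set S1) P"
        using continuous_on_G[OF h] mem_S1_iff[OF h] unfolding P_def
        by (intro continuous_closedin_preimage_gen) auto
      then have P: "closed P" by (meson closed_sphere closedin_closed_trans)
      have *: "compact (C \<inter> P) \<and> C \<inter> P \<noteq> {}" if "C \<in> \<F>" for C
      proof -
        have "\<not> h ` C \<subseteq> V0" "C \<subseteq> S1" using \<F>(2) that h assms(3) by (auto simp: \<N>_def)
        then obtain x where "x \<in> C" "x \<in> S1" "h x \<notin> V0" by blast
        then have "x \<in> P" using mem_S1_iff[OF h, of x] unfolding P_def by blast
        then show ?thesis using cc[OF that] P \<open>x \<in> C\<close> by blast
      qed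
      have "\<Inter> ((\<lambda>C. C \<inter> P) ` \<F>) \<noteq> {}"
      proof (rule compact_chain)
        show "compact S" if "S \<in> (\<lambda>C. C \<inter> P) ` \<F>" for S using that * by blast
        show "{} \<notin> (\<lambda>C. C \<inter> P) ` \<F>" using * by blast
        show "S \<subseteq> T \<or> T \<subseteq> S" if "S \<in> (\<lambda>C. C \<inter> P) ` \<F> \<and> T \<in> (\<lambda>C. C \<inter> P) ` \<F>" for S T
          using that lin by blast
      qed
      then obtain x where "x \<in> \<Inter>\<F>" "x \<in> P" using \<F>(1) by blast
      then show False using hV unfolding P_def by blast
    qed
    ultimately show ?thesis by (simp add: \<N>_def)
  qed
  \<comment> \<open>Complements turn the search for a minimal set into one for a maximal
    set.\<close>
  have "\<exists>M\<in>uminus ` \<N>. \<forall>X\<in>uminus ` \<N>. M \<subseteq> X \<longrightarrow> X = M"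
  proof (rule subset_Zorn_nonempty)
    have "C0 \<in> \<N>" using assms by (simp add: \<N>_def)
    then show "uminus ` \<N> \<noteq> {}" by blast
    fix \<C> assume \<C>: "\<C> \<noteq> {}" "subset.chain (uminus ` \<N>) \<C>"
    have "\<Inter>(uminus ` \<C>) \<in> \<N>"
    proof (rule Inter)
      show "uminus ` \<C> \<noteq> {}" using \<C>(1) by blast
      have "\<C> \<subseteq> uminus ` \<N>" using \<C>(2) by (simp add: subset_chain_def)
      then show "uminus ` \<C> \<subseteq> \<N>" by force
      fix S T assume "S \<in> uminus ` \<C> \<and> T \<in> uminus ` \<C>"
      then obtain S' T' where "S = - S'" "T = - T'" "S' \<in> \<C>" "T' \<in> \<C>" by blast
      moreover from this have "S' \<subseteq> T' \<or> T' \<subseteq> S'" using \<C>(2) by (simp add: subset_chain_def)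
      ultimately show "S \<subseteq> T \<or> T \<subseteq> S" by auto
    qed
    moreover have "\<Union>\<C> = - \<Inter>(uminus ` \<C>)" by auto
    ultimately show "\<Union>\<C> \<in> uminus ` \<N>" by (rule rev_image_eqI)
  qed
  then have "\<exists>A\<in>\<N>. \<forall>X\<in>\<N>. X \<subseteq> A \<longrightarrow> X = A" by simp
  then obtain A where A: "A \<in> \<N>" and max: "\<And>X. X \<in> \<N> \<Longrightarrow> X \<subseteq> A \<Longrightarrow> X = A" by blast
  have "C = A" if "closed C" "connected C" "C \<subseteq> A" "\<forall>h\<in>G. \<not> h ` C \<subseteq> V0" for C
  proof -
    have "C \<in> \<N>" using that A by (auto simp: \<N>_def)
    then show ?thesis using max that(3) by blast
  qed
  moreover have "closed A" "connected A" "A \<subseteq> C0" "\<forall>h\<in>G. \<not> h ` A \<subseteq> V0"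
    using A by (simp_all add: \<N>_def)
  ultimately show ?thesis by (intro that)
qed

text \<open>Zorn's lemma yields a minimal closed arc \<^term>\<open>A\<close> that cannot be squeezed into the
  target. An element supported in a small arc \<^term>\<open>V\<close> off \<^term>\<open>A\<close> moves an endpoint of a
  translate of \<^term>\<open>A\<close>, producing two distinct comparable translates.\<close>
lemma contraction:
  assumes min: "\<And>x V. x \<in> S1 \<Longrightarrow> open_S1 V \<Longrightarrow> V \<noteq> {} \<Longrightarrow> \<exists>h\<in>G. h x \<in> V"
    and rist_nontriv: "\<And>V. open_S1 V \<Longrightarrow> V \<noteq> {} \<Longrightarrow> \<exists>s\<in>rist V. s \<noteq> id"
    and K: "narrow K" and V0: "open_S1 V0" "V0 \<noteq> {}"
  shows "\<exists>h\<in>G. h ` K \<subseteq> V0"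
proof (rule ccontr)
  assume contra: "\<not> ?thesis"
  define rigid where "rigid C \<longleftrightarrow> closed C \<and> connected C \<and> C \<subseteq> S1 \<and> (\<forall>h\<in>G. \<not> h ` C \<subseteq> V0)" for C
  have rigid_image: "rigid (g ` C)" if "rigid C" "g \<in> G" for g C
    unfolding rigid_def
  proof (intro conjI ballI)
    show "\<not> h ` g ` C \<subseteq> V0" if "h \<in> G" for h
      using \<open>rigid C\<close> \<open>g \<in> G\<close> that comp_mem[of h g] by (metis image_comp rigid_def)
  qed (use that closed_image connected_image image_subset_S1 in \<open>auto simp: rigid_def\<close>)
  obtain a b where ab: "a < b" "b < a + 2 * pi" "K \<subseteq> carc a b" using narrow_in_carc[OF K] by blast
  define C0 where "C0 = cis ` {a..b}"
  have "K \<subseteq> C0" using ab unfolding C0_def carc_def by auto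
  have C0: "rigid C0"
    unfolding rigid_def
  proof (intro conjI)
    have "compact C0" unfolding C0_def by (intro compact_continuous_image continuous_intros) auto
    then show "closed C0" by (rule compact_imp_closed)
    show "connected C0" unfolding C0_def by (intro connected_continuous_image continuous_intros) auto
    show "C0 \<subseteq> S1" by (auto simp: C0_def)
    show "\<forall>h\<in>G. \<not> h ` C0 \<subseteq> V0" using contra \<open>K \<subseteq> C0\<close> by blast
  qed
  have C0_proper: "\<exists>c\<in>S1. c \<notin> C0"
  proof -
    have "cis ((b + a + 2 * pi) / 2) \<noteq> cis t" if "t \<in> {a..b}" for t
      using cis_eq_imp_eq[of "(b + a + 2 * pi) / 2" t] that ab by (auto simp: abs_if field_simps)
    then have "cis ((b + a + 2 * pi) / 2) \<notin> C0" unfolding C0_def by blast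
    then show ?thesis using cis_in_S1 by blast
  qed
  obtain A where A: "closed A" "connected A" "A \<subseteq> C0" "\<forall>h\<in>G. \<not> h ` A \<subseteq> V0"
    "\<And>C. closed C \<Longrightarrow> connected C \<Longrightarrow> C \<subseteq> A \<Longrightarrow> \<forall>h\<in>G. \<not> h ` C \<subseteq> V0 \<Longrightarrow> C = A"
    using minimal_rigid[OF _ _ _ _ V0, of C0 thesis] C0 unfolding rigid_def by blast
  have A_min: "C = A" if "rigid C" "C \<subseteq> A" for C
    using A(5) that by (simp add: rigid_def)
  have A: "rigid A" "A \<subseteq> C0"
    using A C0 by (auto simp: rigid_def)
  have minimal: "C = g ` A" if "g \<in> G" "rigid C" "C \<subseteq> g ` A" for g C
  proof -
    have "inv g ` C \<subseteq> A" using that by (metis image_inv_image image_mono)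
    then have "inv g ` C = A" using A_min[OF rigid_image[OF that(2) inv_mem[OF that(1)]]] by simp
    then show ?thesis using that(1) by force
  qed
  have A_S1: "A \<subseteq> S1" "closed A" "connected A" and "A \<noteq> {}"
    using A(1) V0 id_mem unfolding rigid_def by blast+
  \<comment> \<open>The arc \<open>V\<close> is chosen off \<open>A\<close> and inside a set that
    \<open>h0\<close> maps into \<open>V0\<close>, so that no translate of \<open>A\<close> can lie
    inside \<open>V\<close>.\<close>
  obtain v where v: "v \<in> S1" "v \<notin> A" using C0_proper A(2) by blast
  obtain h0 where h0: "h0 \<in> G" "h0 v \<in> V0" using min[OF v(1) V0] by blast
  define V1 where "V1 = (S1 - A) \<inter> inv h0 ` V0"
  have "open_S1 (S1 - A)" using A_S1(2) by (auto simp: openin_open)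
  then have "open_S1 V1"
    unfolding V1_def using open_image[OF inv_mem[OF h0(1)] V0(1)] by (rule openin_Int)
  moreover have "v \<in> inv h0 ` V0" using imageI[OF h0(2), of "inv h0"] h0(1) by simp
  then have "v \<in> V1" using v by (simp add: V1_def)
  ultimately obtain p q where pq: "p < q" "q < p + 2 * pi" "carc p q \<subseteq> V1"
    using carc_inside[of V1 "2 * pi"] pi_gt_zero by (metis empty_iff mult_pos_pos zero_less_numeral)
  define V where "V = carc p q"
  have "V \<subseteq> inv h0 ` V0" using pq(3) unfolding V_def V1_def by blast
  then have "h0 ` V \<subseteq> h0 ` inv h0 ` V0" by (rule image_mono)
  then have V: "open_S1 V" "V \<noteq> {}" "V \<inter> A = {}" "h0 ` V \<subseteq> V0"
    using pq h0(1) carc_nonempty[OF pq(1)] open_carc[of q p] unfolding V_def V1_def by auto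
  obtain s where s: "s \<in> rist V" "s \<noteq> id" using rist_nontriv[OF V(1,2)] by blast
  have sG: "s \<in> G" using s rist_G by blast
  \<comment> \<open>A frontier point of \<open>A\<close>: a proper nonempty closed subset of the
    connected circle is not open.\<close>
  obtain e where e: "e \<in> A" "\<And>T. open_S1 T \<Longrightarrow> e \<in> T \<Longrightarrow> \<not> T \<subseteq> A"
  proof -
    have "\<not> open_S1 A"
      using connected_clopen[of S1] connected_S1 closed_subset[OF A_S1(1,2)] \<open>A \<noteq> {}\<close> v by metis
    then show ?thesis using that openin_subopen[of "top_of_set S1" A] by blast
  qed
  obtain w where "w \<in> S1" "s w \<noteq> w" using nontrivial_moves[OF sG s(2)] by blast
  then have "{x \<in> S1. s x \<noteq> x} \<noteq> {}" by blast
  then obtain h where h: "h \<in> G" "s (h e) \<noteq> h e"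
    using min[of e, OF _ moved_open[OF sG]] e(1) A_S1 by blast
  define A' where "A' = h ` A"
  define e1 where "e1 = h e"
  have e1: "e1 \<in> A'" "s e1 \<noteq> e1" "e1 \<in> V" using h e rist_fix[OF s(1)] by (auto simp: A'_def e1_def)
  have A'_S1: "A' \<subseteq> S1" "closed A'" "connected A'" "rigid A'"
    using rigid_image[OF A(1) h(1)] unfolding A'_def by (auto simp: rigid_def)
  have frontier: "\<not> T \<subseteq> A'" if "open_S1 T" "e1 \<in> T" for T
  proof
    assume "T \<subseteq> A'"
    then have "inv h ` T \<subseteq> inv h ` h ` A" unfolding A'_def by (rule image_mono)
    then have "inv h ` T \<subseteq> A" using h(1) by simp
    moreover have "e \<in> inv h ` T" using imageI[OF that(2), of "inv h"] h(1) by (simp add: e1_def)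
    ultimately show False using e(2) open_image[OF inv_mem[OF h(1)] that(1)] by blast
  qed
  have "\<not> A' \<subseteq> V"
    using A'_S1(4) h0(1) V(4) unfolding rigid_def by blast
  then obtain o' where o': "o' \<in> A'" "o' \<notin> V" by blast
  \<comment> \<open>This yields a point \<open>c\<close> off \<open>V\<close> and off
    \<open>A'\<close>. With the circle cut there, \<open>A'\<close> and its image under
    \<open>s\<close> become compact intervals of angles that agree outside
    \<open>(p, q)\<close>.\<close>
  have "\<not> S1 - V \<subseteq> A'"
  proof
    assume "S1 - V \<subseteq> A'"
    then have "A \<subseteq> A'" using V A_S1 by blast
    then have "A = A'" using minimal[OF h(1) A(1)] unfolding A'_def by blast
    then show False using e1 V by blast
  qed
  then obtain c where c: "c \<in> S1" "c \<notin> V" "c \<notin> A'" by blast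
  obtain t where t: "q - 2 * pi \<le> t" "t < q" "c = cis t"
    using S1_cis_cases[OF c(1), of "q - 2 * pi"] by auto
  have "t \<le> p" using t c(2) by (force simp: V_def carc_def)
  have "s ` A' \<subseteq> S1" "closed (s ` A')" "connected (s ` A')" "rigid (s ` A')"
    using rigid_image[OF A'_S1(4) sG] by (auto simp: rigid_def)
  moreover have "c \<notin> s ` A'"
    using c rist_fix[OF s(1)] inj_G[OF sG] by (metis imageE)
  ultimately obtain x' y' where xy': "t < x'" "x' \<le> y'" "y' < t + 2 * pi" "s ` A' = cis ` {x'..y'}"
    using closed_connected_proper_S1[of "s ` A'" c t] c t e1 by blast
  obtain x y where xy: "t < x" "x \<le> y" "y < t + 2 * pi" "A' = cis ` {x..y}"
    using closed_connected_proper_S1[of A' c t] c t e1 A'_S1 by blast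
  have mem: "cis u \<in> A' \<longleftrightarrow> u \<in> {x..y}" "cis u \<in> s ` A' \<longleftrightarrow> u \<in> {x'..y'}" "cis u \<in> V \<longleftrightarrow> u \<in> {p<..<q}"
    if "t < u" "u < t + 2 * pi" for u
  proof -
    have *: "cis u \<in> cis ` S \<longleftrightarrow> u \<in> S" if "S \<subseteq> {t<..<t + 2 * pi}" for S
    proof
      assume "cis u \<in> cis ` S"
      then obtain r where "r \<in> S" "cis r = cis u" by auto
      with that \<open>t < u\<close> \<open>u < t + 2 * pi\<close> cis_eq_imp_eq[of r u] show "u \<in> S"
        by (force simp: abs_if split: if_splits)
    qed auto
    show "cis u \<in> A' \<longleftrightarrow> u \<in> {x..y}" unfolding xy(4) using xy by (intro *) auto
    show "cis u \<in> s ` A' \<longleftrightarrow> u \<in> {x'..y'}" unfolding xy'(4) using xy' by (intro *) auto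
    show "cis u \<in> V \<longleftrightarrow> u \<in> {p<..<q}" unfolding V_def carc_def using t \<open>t \<le> p\<close> by (intro *) auto
  qed
  have outside: "z \<in> s ` A' \<longleftrightarrow> z \<in> A'" if "z \<notin> V" for z
    using that rist_fix[OF s(1)] rist_mem_iff[OF s(1)] by (metis imageE rev_image_eqI)
  have out: "u \<in> {x'..y'} \<longleftrightarrow> u \<in> {x..y}" if "t < u" "u < t + 2 * pi" "u \<notin> {p<..<q}" for u
    using that mem outside by blast
  obtain k where k: "x \<le> k" "k \<le> y" "k \<notin> {p<..<q}"
  proof -
    obtain k where "o' = cis k" "k \<in> {x..y}" using o' xy(4) by blast
    then show ?thesis using that[of k] o' mem(3)[of k] xy by auto
  qed
  \<comment> \<open>Both intervals contain \<open>k\<close> outside \<open>(p, q)\<close> and agree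
    on that side, so they share the endpoint there and are nested.\<close>
  have "{x..y} \<subseteq> {x'..y'} \<or> {x'..y'} \<subseteq> {x..y}"
  proof (cases "k \<ge> q")
    case True
    have "y = y'" using out[of y] out[of y'] out[of k] k xy xy' True by auto
    then show ?thesis by auto
  next
    case False
    then have "k \<le> p" using k by auto
    then have "x = x'" using out[of x] out[of x'] out[of k] k xy xy' by auto
    then show ?thesis by auto
  qed
  then have "A' \<subseteq> s ` A' \<or> s ` A' \<subseteq> A'"
    by (metis image_mono xy(4) xy'(4))
  then have eq: "s ` A' = A'"
  proof
    assume "s ` A' \<subseteq> A'"
    then show ?thesis
      using minimal[OF h(1) rigid_image[OF A'_S1(4) sG]] by (simp add: A'_def)
  next
    assume "A' \<subseteq> s ` A'"
    moreover have "s ` A' = (s \<circ> h) ` A" by (simp add: A'_def image_comp)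
    ultimately show ?thesis
      using minimal[OF comp_mem[OF sG h(1)] A'_S1(4)] by simp
  qed
  \<comment> \<open>Since \<open>s\<close> preserves \<open>A'\<close>, both \<open>e1\<close> and
    \<open>s e1\<close> are frontier points of it. Being distinct, they are its two endpoints; lying
    in \<open>V\<close>, they force all of \<open>A'\<close> into \<open>V\<close>.\<close>
  have endpoint: "u = x \<or> u = y" if "u \<in> {x..y}" "\<And>T. open_S1 T \<Longrightarrow> cis u \<in> T \<Longrightarrow> \<not> T \<subseteq> A'" for u
  proof (rule ccontr)
    assume "\<not> ?thesis"
    then have "cis u \<in> carc x y" using that(1) by (auto simp: carc_def)
    moreover have "open_S1 (carc x y)" using xy(1-3) by (intro open_carc) linarith
    moreover have "carc x y \<subseteq> A'" unfolding xy(4) carc_def by (intro image_mono) auto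
    ultimately show False using that(2) by blast
  qed
  obtain u1 where u1: "e1 = cis u1" "u1 \<in> {x..y}" using e1(1) xy(4) by blast
  have "s e1 \<in> A'" using e1(1) eq by blast
  then obtain u2 where u2: "s e1 = cis u2" "u2 \<in> {x..y}" using xy(4) by blast
  have "u1 = x \<or> u1 = y" using endpoint[OF u1(2)] frontier unfolding u1(1) by blast
  moreover have "\<not> T \<subseteq> A'" if T: "open_S1 T" "cis u2 \<in> T" for T
  proof
    assume "T \<subseteq> A'"
    then have "inv s ` T \<subseteq> inv s ` s ` A'" unfolding eq by (rule image_mono)
    then have "inv s ` T \<subseteq> A'" using sG by simp
    moreover have "e1 \<in> inv s ` T" using imageI[OF T(2), of "inv s"] sG by (simp flip: u2(1))
    ultimately show False using frontier open_image[OF inv_mem[OF sG] T(1)] by blast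
  qed
  then have "u2 = x \<or> u2 = y" using endpoint[OF u2(2)] by blast
  moreover have "u1 \<noteq> u2" using u1(1) u2(1) e1(2) by metis
  moreover have "u1 \<in> {p<..<q}"
    using mem(3)[of u1] u1(2) e1(3) xy(1,3) unfolding u1(1) by simp
  moreover have "s e1 \<in> V" using e1(3) rist_mem_iff[OF s(1)] by simp
  then have "u2 \<in> {p<..<q}"
    using mem(3)[of u2] u2(2) xy(1,3) unfolding u2(1) by simp
  ultimately show False using k by auto
qed

end

section \<open>Triply transitive actions\<close>

locale circle_group = homeo_group +
  assumes minimal: "minimal_action G"
    and proximal: "proximal_action G"
    and not_free: "\<not> topologically_free G"
begin

section \<open>Consequences of proximality and of non-freeness\<close>

lemma compress:
  assumes "narrow K" "open_S1 V" "V \<noteq> {}"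
  shows "\<exists>g\<in>G. g ` K \<subseteq> V"
proof -
  obtain a b where ab: "a < b" "b < a + 2 * pi" "K \<subseteq> carc a b"
    using narrow_in_carc[OF assms(1)] by blast
  obtain c d where cd: "c < d" "d < c + 2 * pi" "carc c d \<subseteq> V"
    using carc_inside[OF assms(2,3), of "2 * pi"] pi_gt_zero by (metis mult_pos_pos zero_less_numeral)
  obtain g where "g \<in> G" "g ` carc a b \<subseteq> carc c d"
    using proximal is_open_interval_carc[OF ab(1,2)] is_open_interval_carc[OF cd(1,2)] carc_nonempty[OF cd(1)]
    unfolding proximal_action_def by blast
  with ab cd show ?thesis by blast
qed

text \<open>A nontrivial element fixing an open set pointwise is supported in a narrow set;
  conjugation by a compressing element moves that support into \<open>V\<close>.\<close>

lemma rist_nontrivial: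
  assumes "open_S1 V" "V \<noteq> {}"
  shows "\<exists>s\<in>rist V. s \<noteq> id"
proof -
  obtain f where f: "f \<in> G" "f \<noteq> id" and ne: "(top_of_set S1) interior_of {x \<in> S1. f x = x} \<noteq> {}"
    using not_free unfolding topologically_free_def by blast
  let ?F = "(top_of_set S1) interior_of {x \<in> S1. f x = x}"
  have F: "open_S1 ?F" "?F \<subseteq> {x \<in> S1. f x = x}" by (simp_all add: interior_of_subset)
  have "narrow (S1 - ?F)"
    unfolding narrow_def using F ne by (intro conjI exI[of _ ?F]) auto
  then obtain g where g: "g \<in> G" "g ` (S1 - ?F) \<subseteq> V" using compress assms by blast
  have "f x = x" if "x \<notin> S1" for x using homeo[OF f(1)] that by metis
  then have "f \<in> rist (S1 - ?F)" using f(1) F(2) unfolding rist_def by blast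
  then have s: "g \<circ> f \<circ> inv g \<in> rist V"
    using rist_conj[OF g(1)] rist_mono g(2) by blast
  obtain x where x: "f x \<noteq> x" using f(2) by (auto simp: fun_eq_iff)
  then have "(g \<circ> f \<circ> inv g) (g x) \<noteq> g x" using g(1) by (simp add: inj_G)
  then have "g \<circ> f \<circ> inv g \<noteq> id" by (metis id_apply)
  with s show ?thesis by blast
qed

text \<open>If \<open>a\<close> moves a small open \<open>W\<close> off itself and \<open>b\<close>
  is nontrivial in \<open>rist W\<close>, then \<open>a\<close> conjugates \<open>b\<close> to an
  element supported off \<open>W\<close>, hence different from \<open>b\<close>.\<close>

lemma rist_noncommuting:
  assumes "open_S1 V" "V \<noteq> {}"
  obtains a b where "a \<in> rist V" "b \<in> rist V" "a \<circ> b \<noteq> b \<circ> a"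
proof -
  obtain a where a: "a \<in> rist V" "a \<noteq> id" using rist_nontrivial[OF assms] by blast
  have aG: "a \<in> G" using a rist_G by blast
  obtain x where x: "a x \<noteq> x" using nontrivial_moves[OF aG a(2)] by blast
  then have "x \<in> V" using rist_fix[OF a(1)] by blast
  then obtain W where W: "open_S1 W" "x \<in> W" "W \<subseteq> V" "a ` W \<inter> W = {}"
    using displaced_nbhd[OF aG x _ assms(1)] by blast
  obtain b where b: "b \<in> rist W" "b \<noteq> id" using rist_nontrivial[OF W(1)] W(2) by blast
  have bG: "b \<in> G" using b rist_G by blast
  obtain y where y: "b y \<noteq> y" using nontrivial_moves[OF bG b(2)] by blast
  then have "y \<in> W" using rist_fix[OF b(1)] by blast
  then have "a y \<notin> W" using W(4) by blast
  then have "b (a y) = a y" using rist_fix[OF b(1)] by blast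
  moreover have "a (b y) \<noteq> a y" using y inj_G[OF aG] by blast
  ultimately have "a \<circ> b \<noteq> b \<circ> a" by (metis comp_apply)
  then show ?thesis using that a(1) rist_mono[OF b(1) W(3)] by blast
qed

lemma orbit_not_singleton: "z \<in> S1 \<Longrightarrow> \<exists>g\<in>G. g z \<noteq> z"
proof (rule ccontr)
  assume z: "z \<in> S1" "\<not> (\<exists>g\<in>G. g z \<noteq> z)"
  then have "orbit G z \<subseteq> {z}" by (auto simp: orbit_def)
  then have "closure (orbit G z) \<subseteq> {z}" by (intro closure_minimal) auto
  then have "S1 \<subseteq> {z}" using minimal z(1) unfolding minimal_action_def by blast
  then show False using infinite_S1 finite_subset by blast
qed

end

locale triple_action = circle_group +
  fixes \<Omega> :: "'b set" and act :: "(complex \<Rightarrow> complex) \<Rightarrow> 'b \<Rightarrow> 'b"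
  assumes action: "is_action G \<Omega> act"
    and faithful: "faithful_action G \<Omega> act"
    and three_transitive: "three_transitive G \<Omega> act"
begin

lemma act_mem [simp]: "g \<in> G \<Longrightarrow> w \<in> \<Omega> \<Longrightarrow> act g w \<in> \<Omega>"
  and act_id [simp]: "w \<in> \<Omega> \<Longrightarrow> act id w = w"
  and act_comp: "g \<in> G \<Longrightarrow> h \<in> G \<Longrightarrow> w \<in> \<Omega> \<Longrightarrow> act (g \<circ> h) w = act g (act h w)"
  using action by (auto simp: is_action_def)

lemma act_inv_act [simp]: "g \<in> G \<Longrightarrow> w \<in> \<Omega> \<Longrightarrow> act (inv g) (act g w) = w"
  and act_act_inv [simp]: "g \<in> G \<Longrightarrow> w \<in> \<Omega> \<Longrightarrow> act g (act (inv g) w) = w"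
  by (simp_all flip: act_comp)

lemma act_inj: "g \<in> G \<Longrightarrow> w \<in> \<Omega> \<Longrightarrow> w' \<in> \<Omega> \<Longrightarrow> act g w = act g w' \<longleftrightarrow> w = w'"
  by (metis act_inv_act)

lemma act_eq_imp_eq:
  assumes "f \<in> G" "g \<in> G" "\<And>w. w \<in> \<Omega> \<Longrightarrow> act f w = act g w"
  shows "f = g"
proof -
  have "inv g \<circ> f = id"
    using faithful assms by (auto simp: faithful_action_def act_comp)
  then have "g \<circ> (inv g \<circ> f) = g" by simp
  then show ?thesis using assms(2) by (simp flip: comp_assoc)
qed

text \<open>\<open>three_transitive\<close> is vacuous on fewer than three points. A faithful action
  on at most two points would make \<open>G\<close> abelian, against
  \<open>rist_noncommuting\<close>.\<close>

lemma third_point: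
  assumes "v1 \<in> \<Omega>" "v2 \<in> \<Omega>"
  obtains v3 where "v3 \<in> \<Omega>" "v3 \<noteq> v1" "v3 \<noteq> v2"
proof (rule ccontr)
  assume "\<not> thesis"
  then have \<Omega>: "\<Omega> = {v1, v2}" using assms that by blast
  have "open_S1 S1" "S1 \<noteq> {}" by auto
  then obtain a b where ab: "a \<in> rist S1" "b \<in> rist S1" "a \<circ> b \<noteq> b \<circ> a"
    using rist_noncommuting by metis
  have G: "a \<in> G" "b \<in> G" using ab rist_G by auto
  have perm: "(act g v1 = v1 \<and> act g v2 = v2) \<or> (act g v1 = v2 \<and> act g v2 = v1)" if "g \<in> G" for g
    using that assms act_mem[of g v1] act_mem[of g v2] act_inj[of g v1 v2] \<Omega> by auto
  have "act (a \<circ> b) w = act (b \<circ> a) w" if "w \<in> \<Omega>" for w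
    using that perm[OF G(1)] perm[OF G(2)] \<Omega> G by (auto simp: act_comp)
  then show False using act_eq_imp_eq[of "a \<circ> b" "b \<circ> a"] G ab(3) by simp
qed

lemma transitive3:
  assumes "v1 \<in> \<Omega>" "v2 \<in> \<Omega>" "v3 \<in> \<Omega>" "v1 \<noteq> v2" "v1 \<noteq> v3" "v2 \<noteq> v3"
    "w1 \<in> \<Omega>" "w2 \<in> \<Omega>" "w3 \<in> \<Omega>" "w1 \<noteq> w2" "w1 \<noteq> w3" "w2 \<noteq> w3"
  obtains g where "g \<in> G" "act g v1 = w1" "act g v2 = w2" "act g v3 = w3"
  using three_transitive assms unfolding three_transitive_def by metis

lemma transitive2:
  assumes "v1 \<in> \<Omega>" "v2 \<in> \<Omega>" "v1 \<noteq> v2" "w1 \<in> \<Omega>" "w2 \<in> \<Omega>" "w1 \<noteq> w2"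
  obtains g where "g \<in> G" "act g v1 = w1" "act g v2 = w2"
proof -
  obtain v3 where v3: "v3 \<in> \<Omega>" "v3 \<noteq> v1" "v3 \<noteq> v2" using third_point assms by metis
  obtain w3 where w3: "w3 \<in> \<Omega>" "w3 \<noteq> w1" "w3 \<noteq> w2" using third_point assms by metis
  from transitive3[of v1 v2 v3 w1 w2 w3] v3 w3 assms that show ?thesis by metis
qed

lemma transitive1:
  assumes "v \<in> \<Omega>" "w \<in> \<Omega>"
  obtains g where "g \<in> G" "act g v = w"
proof -
  obtain v2 where v2: "v2 \<in> \<Omega>" "v2 \<noteq> v" using third_point assms by metis
  obtain w2 where w2: "w2 \<in> \<Omega>" "w2 \<noteq> w" using third_point assms by metis
  from transitive2[of v v2 w w2] v2 w2 assms that show ?thesis by metis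
qed

definition pstab :: "'b \<Rightarrow> (complex \<Rightarrow> complex) set" where
  "pstab w = {g \<in> G. act g w = w}"

lemma pstab_G: "g \<in> pstab w \<Longrightarrow> g \<in> G"
  and pstab_act: "g \<in> pstab w \<Longrightarrow> act g w = w"
  by (simp_all add: pstab_def)

lemma homeo_group_pstab: "w \<in> \<Omega> \<Longrightarrow> homeo_group (pstab w)"
proof (unfold_locales, unfold homeo_subgroup_def, intro conjI ballI)
  assume w: "w \<in> \<Omega>"
  show "pstab w \<subseteq> Homeo_S1" using homeo_subgroup by (auto simp: pstab_def homeo_subgroup_def)
  show "id \<in> pstab w" using w by (simp add: pstab_def)
  show "f \<circ> g \<in> pstab w" if "f \<in> pstab w" "g \<in> pstab w" for f g
    using that w by (simp add: pstab_def act_comp)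
  show "inv f \<in> pstab w" if "f \<in> pstab w" for f
    using that w act_inv_act[of f w] by (simp add: pstab_def)
qed

lemma pstab_comp_inv:
  assumes "w \<in> \<Omega>" "f \<in> G" "g \<in> G" "act f w = act g w"
  shows "inv g \<circ> f \<in> pstab w"
  using assms by (simp add: pstab_def act_comp)

lemma pstab_conj:
  assumes "w \<in> \<Omega>" "g \<in> G" "s \<in> G"
  shows "g \<circ> s \<circ> inv g \<in> pstab (act g w) \<longleftrightarrow> s \<in> pstab w"
  using assms by (simp add: pstab_def act_comp act_inj)

text \<open>Symmetry under permutations of triples forces an ultrametric relation to be empty as soon as
  it is disjoint at one triple.\<close>
lemma three_point:
  fixes D :: "'b \<Rightarrow> 'b \<Rightarrow> complex set \<Rightarrow> bool"
  assumes equivariant: "\<And>g w w' U. g \<in> G \<Longrightarrow> w \<in> \<Omega> \<Longrightarrow> w' \<in> \<Omega> \<Longrightarrow> D w w' U \<Longrightarrow> D (act g w) (act g w') (g ` U)"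
    and sym: "\<And>w w' U. D w w' U \<Longrightarrow> D w' w U"
    and ultra: "\<And>w0 w1 w2 U. w0 \<in> \<Omega> \<Longrightarrow> w1 \<in> \<Omega> \<Longrightarrow> w2 \<in> \<Omega> \<Longrightarrow> D w1 w2 U \<Longrightarrow> D w0 w1 U \<or> D w0 w2 U"
    and w: "w0 \<in> \<Omega>" "w1 \<in> \<Omega>" "w2 \<in> \<Omega>" "w0 \<noteq> w1" "w0 \<noteq> w2" "w1 \<noteq> w2"
    and disj: "\<And>U. \<not> (D w0 w1 U \<and> D w0 w2 U)"
    and v: "v1 \<in> \<Omega>" "v2 \<in> \<Omega>" "v1 \<noteq> v2"
  shows "\<not> D v1 v2 U"
proof
  assume D: "D v1 v2 U"
  have *: False if u: "u0 \<in> \<Omega>" "u1 \<in> \<Omega>" "u2 \<in> \<Omega>" "u0 \<noteq> u1" "u0 \<noteq> u2" "u1 \<noteq> u2"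
    and "D u0 u1 U" "D u0 u2 U" for u0 u1 u2
  proof -
    obtain g where "g \<in> G" "act g u0 = w0" "act g u1 = w1" "act g u2 = w2"
      using transitive3[of u0 u1 u2 w0 w1 w2] u w by metis
    then show False
      using disj[of "g ` U"] equivariant[of g u0 u1 U] equivariant[of g u0 u2 U] that by auto
  qed
  obtain v0 where v0: "v0 \<in> \<Omega>" "v0 \<noteq> v1" "v0 \<noteq> v2" using third_point v by metis
  \<comment> \<open>In either case \<open>U\<close> lies in two relations with a common base point,
    \<open>v1\<close> or \<open>v2\<close>.\<close>
  from ultra[OF v0(1) v(1,2) D] show False
  proof
    assume "D v0 v1 U"
    then show False using *[of v1 v0 v2] v0 v D sym by metis
  next
    assume "D v0 v2 U"
    then show False using *[of v2 v0 v1] v0 v D sym by metis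
  qed
qed

text \<open>Double transitivity gives \<open>G = H \<union> H g H\<close> for
  \<open>H = pstab w0\<close> and any \<open>g\<close> in \<open>G\<close> outside \<open>H\<close>.
  If such a \<open>g\<close> fixed \<open>z\<close>, all of \<open>G\<close> would; so
  \<open>H\<close> is the whole stabilizer of \<open>z\<close>, and sending \<open>g w0\<close> to
  \<open>g z\<close> is the conjugacy.\<close>

lemma fixed_point_conjugate:
  assumes w0: "w0 \<in> \<Omega>" and z: "z \<in> S1" and fixes_z: "\<And>h. h \<in> pstab w0 \<Longrightarrow> h z = z"
  shows "conjugate_to_circle_set G \<Omega> act (orbit G z)"
proof -
  have stab: "act g w0 = w0" if g: "g \<in> G" "g z = z" for g
  proof (rule ccontr)
    assume gw: "act g w0 \<noteq> w0"
    have "f z = z" if f: "f \<in> G" for f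
    proof (cases "act f w0 = w0")
      case True
      then show ?thesis using fixes_z f by (simp add: pstab_def)
    next
      case False
      then obtain h where h: "h \<in> G" "act h w0 = w0" "act h (act g w0) = act f w0"
        using transitive2[of w0 "act g w0" w0 "act f w0"] w0 g f gw by (metis act_mem)
      then have "inv f \<circ> (h \<circ> g) \<in> pstab w0"
        using w0 g f by (intro pstab_comp_inv) (simp_all add: act_comp)
      then have "inv f (h (g z)) = z" using fixes_z by fastforce
      moreover have "h z = z" using h fixes_z by (simp add: pstab_def)
      ultimately have "inv f z = z" using g by simp
      then show ?thesis using f apply_inv by metis
    qed
    then show False using orbit_not_singleton[OF z] by blast
  qed
  have iff: "f z = g z \<longleftrightarrow> act f w0 = act g w0" if "f \<in> G" "g \<in> G" for f g
  proof
    assume "f z = g z"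
    then have "(inv g \<circ> f) z = z" using that by simp
    then have "act (inv g \<circ> f) w0 = w0" using stab that by (metis comp_mem inv_mem)
    then have "act g (act (inv g \<circ> f) w0) = act g w0" by simp
    then show "act f w0 = act g w0" using that w0 by (simp add: act_comp)
  next
    assume "act f w0 = act g w0"
    then have "(inv g \<circ> f) z = z" using fixes_z pstab_comp_inv[OF w0] that by metis
    then have "g ((inv g \<circ> f) z) = g z" by simp
    then show "f z = g z" using that by simp
  qed
  define to where "to w = (SOME g. g \<in> G \<and> act g w0 = w)" for w
  have to: "to w \<in> G" "act (to w) w0 = w" if "w \<in> \<Omega>" for w
  proof -
    have "\<exists>g. g \<in> G \<and> act g w0 = w" using transitive1[OF w0 that] by blast
    then have "to w \<in> G \<and> act (to w) w0 = w" unfolding to_def by (rule someI_ex)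
    then show "to w \<in> G" "act (to w) w0 = w" by auto
  qed
  have "bij_betw (\<lambda>w. to w z) \<Omega> (orbit G z)"
  proof (rule bij_betw_imageI)
    show "inj_on (\<lambda>w. to w z) \<Omega>" by (rule inj_onI) (metis iff to)
    show "(\<lambda>w. to w z) ` \<Omega> = orbit G z"
    proof (intro equalityI subsetI)
      fix y assume "y \<in> orbit G z"
      then obtain g where g: "g \<in> G" "y = g z" by (auto simp: orbit_def)
      then have "to (act g w0) z = g z" using iff[of "to (act g w0)" g] to[of "act g w0"] w0 by simp
      then show "y \<in> (\<lambda>w. to w z) ` \<Omega>" using g w0 by (intro image_eqI[of _ _ "act g w0"]) auto
    qed (use to in \<open>auto simp: orbit_def\<close>)
  qed
  moreover have "to (act g w) z = g (to w z)" if "g \<in> G" "w \<in> \<Omega>" for g w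
    using iff[of "to (act g w)" "g \<circ> to w"] to[OF that(2)] to[of "act g w"] that w0 by (simp add: act_comp)
  ultimately show ?thesis unfolding conjugate_to_circle_set_def by blast
qed

text \<open>If \<^term>\<open>X\<close> had two points, then among the translates of \<^term>\<open>X\<close> there would be both
  triples in which the first set separates the other two and triples in which it does not.\<close>
lemma invariant_closed_conjugate:
  assumes w0: "w0 \<in> \<Omega>" and X: "closed X" "X \<noteq> {}" "X \<subseteq> S1" "X \<noteq> S1"
    and inv: "\<And>h. h \<in> pstab w0 \<Longrightarrow> h ` X \<subseteq> X"
  shows "\<exists>z\<in>S1. conjugate_to_circle_set G \<Omega> act (orbit G z)"
proof -
  have sub: "f ` X \<subseteq> g ` X" if "f \<in> G" "g \<in> G" "act f w0 = act g w0" for f g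
  proof -
    have "g ` (inv g \<circ> f) ` X \<subseteq> g ` X" using inv[OF pstab_comp_inv[OF w0 that]] by (rule image_mono)
    then show ?thesis using that by (simp add: image_comp flip: comp_assoc)
  qed
  have translate: "f ` X = g ` X" if "f \<in> G" "g \<in> G" "act f w0 = act g w0" for f g
    using sub[OF that] sub[OF that(2,1)] that(3) by simp
  have narrow: "narrow X"
    unfolding narrow_def
  proof (intro conjI exI[of _ "S1 - X"])
    show "open_S1 (S1 - X)" using X(1) by (auto simp: openin_open)
  qed (use X in auto)
  have "p = q" if pq: "p \<in> X" "q \<in> X" for p q
  proof (rule ccontr)
    assume "p \<noteq> q"
    then obtain a b where ab: "p = cis a" "q = cis b" "a < b" "b < a + 2 * pi"
      using distinct_S1_cis[of p q] pq X(3) by blast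
    have squeeze: "\<exists>g\<in>G. g ` X \<subseteq> carc c d" if "c < d" "d \<le> c + 2 * pi" for c d
      using compress[OF narrow open_carc[OF that(2)]] carc_nonempty[OF that(1)] by blast
    \<comment> \<open>The sets \<open>f1 X\<close> and \<open>f2 X\<close> lie on different sides of
      the pair \<open>p\<close>, \<open>q\<close>, so \<open>X\<close> separates them. The sets
      \<open>g0 X\<close>, \<open>g1 X\<close>, \<open>g2 X\<close>, placed at angles below
      \<open>5 < 2 * pi\<close>, form a triple of the other kind: \<open>carc 2 5\<close> joins the
      last two off the first.\<close>
    obtain f1 where f1: "f1 \<in> G" "f1 ` X \<subseteq> carc a b" using squeeze[of a b] ab by auto
    obtain f2 where f2: "f2 \<in> G" "f2 ` X \<subseteq> carc b (a + 2 * pi)" using squeeze[of b "a + 2 * pi"] ab by auto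
    obtain g0 where g0: "g0 \<in> G" "g0 ` X \<subseteq> carc 0 1" using squeeze[of 0 1] pi_gt3 by auto
    obtain g1 where g1: "g1 \<in> G" "g1 ` X \<subseteq> carc 2 3" using squeeze[of 2 3] pi_gt3 by auto
    obtain g2 where g2: "g2 \<in> G" "g2 ` X \<subseteq> carc 4 5" using squeeze[of 4 5] pi_gt3 by auto
    have distinct: "act f w0 \<noteq> act g w0" if "f \<in> G" "g \<in> G" "f ` X \<inter> g ` X = {}" for f g
      using translate[OF that(1,2)] that(3) X(2) by auto
    have p: "p \<notin> carc a b" "p \<notin> carc b (a + 2 * pi)"
      unfolding ab(1) using ab cis_notin_carc[of a a b] cis_notin_carc[of a b "a + 2 * pi"] by auto
    have q: "q \<notin> carc a b" "q \<notin> carc b (a + 2 * pi)"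
      unfolding ab(2) using ab cis_notin_carc[of b b "a + 2 * pi"] cis_notin_carc[of "b - 2 * pi" a b] by auto
    have ab_disj: "carc a b \<inter> carc b (a + 2 * pi) = {}" by (rule carc_disjoint) auto
    have "w0 \<noteq> act f1 w0" "w0 \<noteq> act f2 w0"
      using translate[of id f1] translate[of id f2] w0 f1 f2 p pq by auto
    moreover have "act f1 w0 \<noteq> act f2 w0"
      using distinct[OF f1(1) f2(1)] f1(2) f2(2) ab_disj by blast
    moreover have disj: "carc 0 1 \<inter> carc 2 3 = {}" "carc 0 1 \<inter> carc 4 5 = {}" "carc 2 3 \<inter> carc 4 5 = {}"
      using pi_gt3 by (auto intro!: carc_disjoint)
    have "act g0 w0 \<noteq> act g1 w0"
      using distinct[OF g0(1) g1(1)] g0(2) g1(2) disj(1) by blast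
    moreover have "act g0 w0 \<noteq> act g2 w0"
      using distinct[OF g0(1) g2(1)] g0(2) g2(2) disj(2) by blast
    moreover have "act g1 w0 \<noteq> act g2 w0"
      using distinct[OF g1(1) g2(1)] g1(2) g2(2) disj(3) by blast
    ultimately obtain g where g: "g \<in> G" "act g w0 = act g0 w0"
      "act g (act f1 w0) = act g1 w0" "act g (act f2 w0) = act g2 w0"
      using transitive3[of w0 "act f1 w0" "act f2 w0" "act g0 w0" "act g1 w0" "act g2 w0" thesis]
        w0 f1(1) f2(1) g0(1) g1(1) g2(1) by simp
    have "g ` X = g0 ` X" using translate[OF g(1) g0(1) g(2)] .
    then have gX: "g ` X \<subseteq> carc 0 1" using g0 by simp
    have "(g \<circ> f1) ` X = g1 ` X" using translate[of "g \<circ> f1" g1] g f1 g1 w0 by (simp add: act_comp)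
    then have gf1: "g ` f1 ` X \<subseteq> carc 2 3" using g1 by (simp add: image_comp)
    have "(g \<circ> f2) ` X = g2 ` X" using translate[of "g \<circ> f2" g2] g f2 g2 w0 by (simp add: act_comp)
    then have gf2: "g ` f2 ` X \<subseteq> carc 4 5" using g2 by (simp add: image_comp)
    \<comment> \<open>Pulled back by \<open>g\<close>, the joining arc avoids \<open>p\<close> and
      \<open>q\<close> but contains \<open>f1 X\<close> and \<open>f2 X\<close>.\<close>
    define C where "C = inv g ` carc 2 5"
    have "connected C" "C \<subseteq> S1"
      unfolding C_def using g(1) connected_image connected_carc carc_subset_S1 image_subset_S1 by auto
    moreover have "carc 0 1 \<inter> carc 2 5 = {}" using pi_gt3 by (intro carc_disjoint) auto
    then have "g p \<notin> carc 2 5" "g q \<notin> carc 2 5" using gX pq by blast+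
    then have "p \<notin> C" "q \<notin> C" 
      unfolding C_def using g(1) by (simp_all add: mem_image_inv inv_inv_eq[OF bij_G])
    ultimately have "C \<subseteq> carc a b \<or> C \<subseteq> carc b (a + 2 * pi)"
      using connected_in_carc[of C a b] ab by simp
    moreover have "f1 ` X \<subseteq> C"
    proof -
      have "inv g ` g ` f1 ` X \<subseteq> inv g ` carc 2 5"
        using gf1 carc_mono[of 2 2 3 5] by (intro image_mono) auto
      then show ?thesis using g(1) by (simp add: C_def)
    qed
    moreover have "f2 ` X \<subseteq> C"
    proof -
      have "inv g ` g ` f2 ` X \<subseteq> inv g ` carc 2 5"
        using gf2 carc_mono[of 2 4 5 5] by (intro image_mono) auto
      then show ?thesis using g(1) by (simp add: C_def)
    qed
    moreover have "f1 ` X \<noteq> {}" "f2 ` X \<noteq> {}" using X by auto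
    ultimately show False using f1 f2 ab_disj by blast
  qed
  then obtain z where z: "X = {z}" using X(2) by blast
  then have "z \<in> S1" "\<And>h. h \<in> pstab w0 \<Longrightarrow> h z = z" using X inv by auto
  then show ?thesis using fixed_point_conjugate[OF w0] by blast
qed

end

section \<open>Elements with small support and fixed points\<close>

lemma carcI: "a < t \<Longrightarrow> t < b \<Longrightarrow> cis t \<in> carc a b"
  by (simp add: carc_def)

text \<open>The missed points \<open>s1\<close>, \<open>s2\<close> confine \<open>U\<close> to one
  side. On the outer side, a further missed point \<open>t\<close> between \<open>B2\<close> and
  \<open>A1 + 2 * pi\<close> would separate \<open>u1\<close> from \<open>u2\<close>, so
  \<open>U\<close> fills that arc.\<close>

lemma connected_between_arcs:
  assumes U: "connected U" "U \<subseteq> S1"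
    and A: "A1 < B1" "B1 < A2" "A2 < B2" "B2 < A1 + 2 * pi"
    and s1: "A1 < s1" "s1 < B1" "cis s1 \<notin> U" and u1: "A1 < u1" "u1 < B1" "cis u1 \<in> U"
    and s2: "A2 < s2" "s2 < B2" "cis s2 \<notin> U" and u2: "A2 < u2" "u2 < B2" "cis u2 \<in> U"
  shows "U \<subseteq> carc A1 B2 \<or> (cis ` {B2..A1 + 2 * pi} \<subseteq> U \<and> U \<subseteq> carc A2 (B1 + 2 * pi))"
proof -
  have "U \<subseteq> carc s1 s2 \<or> U \<subseteq> carc s2 (s1 + 2 * pi)"
    using U s1 s2 A by (intro connected_in_carc) auto
  then show ?thesis
  proof
    assume "U \<subseteq> carc s1 s2"
    moreover have "carc s1 s2 \<subseteq> carc A1 B2" using s1 s2 by (intro carc_mono) auto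
    ultimately show ?thesis by blast
  next
    assume outer: "U \<subseteq> carc s2 (s1 + 2 * pi)"
    have disj: "carc s1 s2 \<inter> carc s2 (s1 + 2 * pi) = {}" by (rule carc_disjoint) auto
    have "cis u1 \<notin> carc s1 s2" "cis u2 \<notin> carc s1 s2" using outer disj u1 u2 by blast+
    then have "\<not> (s1 < u1 \<and> u1 < s2)" "\<not> (s1 < u2 \<and> u2 < s2)" using carcI by auto
    moreover have "u1 \<noteq> s1" "u2 \<noteq> s2" using s1 s2 u1 u2 by auto
    ultimately have u: "u1 < s1" "s2 < u2" using A s1 s2 u1 u2 by linarith+
    have "cis ` {B2..A1 + 2 * pi} \<subseteq> U"
    proof (rule ccontr)
      assume "\<not> ?thesis"
      then obtain t where "t \<in> {B2..A1 + 2 * pi}" and t3: "cis t \<notin> U" by blast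
      then have t: "B2 \<le> t" "t \<le> A1 + 2 * pi" by auto
      have "U \<subseteq> carc t (s1 + 2 * pi) \<or> U \<subseteq> carc (s1 + 2 * pi) (t + 2 * pi)"
        using U s1 t t3 A by (intro connected_in_carc) auto
      then show False
      proof
        assume "U \<subseteq> carc t (s1 + 2 * pi)"
        moreover have "cis u2 \<in> carc s1 t" using u2 u t s1 A by (intro carcI) linarith+
        moreover have "carc s1 t \<inter> carc t (s1 + 2 * pi) = {}" by (rule carc_disjoint) auto
        ultimately show False using u2 by blast
      next
        assume "U \<subseteq> carc (s1 + 2 * pi) (t + 2 * pi)"
        moreover have "cis (u1 + 2 * pi) \<in> carc t (s1 + 2 * pi)"
          using u1 u t by (intro carcI) linarith+
        then have "cis u1 \<in> carc t (s1 + 2 * pi)" by simp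
        moreover have "carc t (s1 + 2 * pi) \<inter> carc (s1 + 2 * pi) (t + 2 * pi) = {}"
          by (rule carc_disjoint) auto
        ultimately show False using u1 by blast
      qed
    qed
    moreover have "carc s2 (s1 + 2 * pi) \<subseteq> carc A2 (B1 + 2 * pi)" using s1 s2 by (intro carc_mono) auto
    ultimately show ?thesis using outer by blast
  qed
qed

section \<open>Triviality of point stabilizers inside arcs\<close>

context triple_action
begin

definition triv :: "complex set \<Rightarrow> 'b \<Rightarrow> bool" where
  "triv U w \<longleftrightarrow> rist U \<inter> pstab w \<subseteq> {id}"

lemma triv_mono: "triv U w \<Longrightarrow> V \<subseteq> U \<Longrightarrow> triv V w"
  unfolding triv_def using rist_mono by blast

lemma triv_image:
  assumes "g \<in> G" "w \<in> \<Omega>"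
  shows "triv (g ` U) (act g w) \<longleftrightarrow> triv U w"
proof -
  have *: "triv (f ` V) (act f v)" if triv: "triv V v" and f: "f \<in> G" and v: "v \<in> \<Omega>" for f V v
    unfolding triv_def
  proof
    fix s assume s: "s \<in> rist (f ` V) \<inter> pstab (act f v)"
    then have sG: "s \<in> G" using rist_G by blast
    have "inv f \<circ> s \<circ> inv (inv f) \<in> rist (inv f ` f ` V)"
      using s f by (intro rist_conj) auto
    moreover have "inv f \<circ> s \<circ> inv (inv f) \<in> pstab (act (inv f) (act f v))"
      using s f v sG pstab_conj[of "act f v" "inv f" s] by simp
    ultimately have "inv f \<circ> s \<circ> inv (inv f) = id"
      using triv f v unfolding triv_def by auto
    then have "f \<circ> (inv f \<circ> s \<circ> f) \<circ> inv f = f \<circ> id \<circ> inv f"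
      using f by (simp add: inv_inv_eq[OF bij_G])
    then have "s = id" using f by (simp add: fun_eq_iff)
    then show "s \<in> {id}" by simp
  qed
  show ?thesis
  proof
    assume "triv (g ` U) (act g w)"
    then have "triv (inv g ` g ` U) (act (inv g) (act g w))" 
      using *[of "g ` U" "act g w" "inv g"] assms by simp
    then show "triv U w" using assms by simp
  qed (use * assms in blast)
qed

text \<open>A group element carrying \<^term>\<open>(w0, a1 w0, a2 w0)\<close> to \<^term>\<open>(w0, a1 w0, a3 w0)\<close> would have
  to conjugate \<^term>\<open>(a1, a2)\<close> to \<^term>\<open>(a1, a3)\<close>, up to elements without open fixed set. This is
  impossible if \<^term>\<open>a1\<close> and \<^term>\<open>a2\<close> have disjoint supports, \<^term>\<open>a1\<close> and \<^term>\<open>a3\<close> do not commute,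
  and the supports of \<^term>\<open>a1\<close> and \<^term>\<open>a3\<close> are not nested and have non-dense union.\<close>
lemma not_all_triv:
  assumes w0: "w0 \<in> \<Omega>" and triv: "\<And>U. narrow U \<Longrightarrow> triv U w0"
  shows False
proof -
  \<comment> \<open>A nontrivial stabilizer element cannot fix an open set, as it would be supported
    in a narrow set.\<close>
  have dense: "\<exists>x\<in>V. s x \<noteq> x" if s: "s \<in> pstab w0" "s \<noteq> id" and V: "open_S1 V" "V \<noteq> {}" for s V
  proof (rule ccontr)
    assume "\<not> ?thesis"
    moreover have "s x = x" if "x \<notin> S1" for x using homeo[OF pstab_G[OF s(1)]] that by metis
    ultimately have "s \<in> rist (S1 - V)" using pstab_G[OF s(1)] unfolding rist_def by blast
    moreover have "narrow (S1 - V)" unfolding narrow_def using V by blast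
    ultimately show False using triv s unfolding triv_def by blast
  qed
  \<comment> \<open>\<open>I1\<close> carries the non-commuting parts of \<open>a1\<close> and
    \<open>a3\<close>, \<open>I2\<close> and \<open>I3\<close> their private parts,
    \<open>I4\<close> the support of \<open>a2\<close>; \<open>I5\<close> is left free. Five unit
    arcs fit because \<open>5 < 2 * pi\<close>.\<close>
  define I1 I2 I3 I4 I5 where I: "I1 = carc 0 1" "I2 = carc 1 2" "I3 = carc 2 3" "I4 = carc 3 4" "I5 = carc 4 5"
  have disj: "I1 \<inter> I2 = {}" "I1 \<inter> I3 = {}" "I1 \<inter> I4 = {}" "I1 \<inter> I5 = {}" "I2 \<inter> I3 = {}" "I2 \<inter> I4 = {}"
    "I2 \<inter> I5 = {}" "I3 \<inter> I4 = {}" "I3 \<inter> I5 = {}" "I4 \<inter> I5 = {}"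
    unfolding I using pi_gt3 by (intro carc_disjoint; simp)+
  have off_I2: "z \<notin> I1 \<union> I3 \<union> I4" if "z \<in> I2" for z using that disj by blast
  have off_I3: "z \<notin> I1 \<union> I2" if "z \<in> I3" for z using that disj by blast
  have off_I5: "z \<notin> I1 \<union> I2 \<union> I3" if "z \<in> I5" for z using that disj by blast
  have op: "open_S1 I1" "open_S1 I2" "open_S1 I3" "open_S1 I4" "open_S1 I5"
    unfolding I using pi_gt3 by (intro open_carc; simp)+
  have ne: "I1 \<noteq> {}" "I2 \<noteq> {}" "I3 \<noteq> {}" "I4 \<noteq> {}" "I5 \<noteq> {}"
    unfolding I by (intro carc_nonempty; simp)+
  obtain b b' where b: "b \<in> rist I1" "b' \<in> rist I1" "b \<circ> b' \<noteq> b' \<circ> b"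
    using rist_noncommuting[OF op(1) ne(1)] by metis
  obtain d where d: "d \<in> rist I2" "d \<noteq> id" using rist_nontrivial[OF op(2) ne(2)] by blast
  obtain d' where d': "d' \<in> rist I3" "d' \<noteq> id" using rist_nontrivial[OF op(3) ne(3)] by blast
  obtain a2 where a2: "a2 \<in> rist I4" "a2 \<noteq> id" using rist_nontrivial[OF op(4) ne(4)] by blast
  have dG: "d \<in> G" "d' \<in> G" using d d' rist_G by auto
  obtain x where x: "x \<in> S1" "d x \<noteq> x" using nontrivial_moves[OF dG(1) d(2)] by blast
  obtain x' where x': "x' \<in> S1" "d' x' \<noteq> x'" using nontrivial_moves[OF dG(2) d'(2)] by blast
  define a1 a3 where a: "a1 = b \<circ> d" "a3 = b' \<circ> d'"
  have a1_I2: "a1 z = d z" if "z \<in> I2" for z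
    using that rist_mem_iff[OF d(1), of z] rist_fix[OF b(1), of "d z"] disj(1)
    by (metis a(1) comp_apply disjoint_iff)
  have a3_I3: "a3 z = d' z" if "z \<in> I3" for z
    using that rist_mem_iff[OF d'(1), of z] rist_fix[OF b(2), of "d' z"] disj(2)
    by (metis a(2) comp_apply disjoint_iff)
  have a1_I1: "a1 z = b z" if "z \<in> I1" for z
    using that rist_fix[OF d(1), of z] disj(1) by (metis a(1) comp_apply disjoint_iff)
  have a3_I1: "a3 z = b' z" if "z \<in> I1" for z
    using that rist_fix[OF d'(1), of z] disj(2) by (metis a(2) comp_apply disjoint_iff)
  have a1: "a1 \<in> rist (I1 \<union> I2)"
    unfolding a using b d rist_mono by (intro rist_comp) blast+
  have a3: "a3 \<in> rist (I1 \<union> I3)"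
    unfolding a using b d' rist_mono by (intro rist_comp) blast+
  have aG: "a1 \<in> G" "a2 \<in> G" "a3 \<in> G" using a1 a2 a3 rist_G by auto
  have x_in: "x \<in> I2" "x' \<in> I3" using x x' rist_fix d(1) d'(1) by blast+
  have a1x: "a1 x \<noteq> x" "a3 x' \<noteq> x'" using x x' a1_I2 a3_I3 x_in by auto
  \<comment> \<open>The quotient of two such elements fixes \<open>I5\<close>, so by
    \<open>dense\<close> they are determined by the image of \<open>w0\<close>.\<close>
  have faithful_off_I5: "f = h" if fh: "f \<in> rist (- I5)" "h \<in> rist (- I5)" "act f w0 = act h w0" for f h
  proof (rule ccontr)
    assume "f \<noteq> h"
    have G: "f \<in> G" "h \<in> G" using fh rist_G by auto
    have "inv h \<circ> f \<noteq> id"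
      using \<open>f \<noteq> h\<close> G by (metis comp_assoc comp_inv comp_id id_comp)
    then obtain z where "z \<in> I5" "(inv h \<circ> f) z \<noteq> z"
      using dense[OF pstab_comp_inv[OF w0 G fh(3)]] op(5) ne(5) by blast
    moreover have "inv h \<circ> f \<in> rist (- I5)" using fh by (intro rist_comp rist_inv)
    ultimately show False using rist_fix by blast
  qed
  have "I1 \<union> I2 \<subseteq> - I5" "I4 \<subseteq> - I5" "I1 \<union> I3 \<subseteq> - I5" using disj by auto
  then have off: "a1 \<in> rist (- I5)" "a2 \<in> rist (- I5)" "a3 \<in> rist (- I5)" "id \<in> rist (- I5)"
    using rist_mono[OF a1] rist_mono[OF a2(1)] rist_mono[OF a3] by simp_all
  have "a1 \<noteq> id" "a3 \<noteq> id" using a1x by auto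
  moreover have "a2 x = x" "a3 x = x" using rist_fix[OF a2(1), of x] rist_fix[OF a3, of x] off_I2[OF x_in(1)] by auto
  then have "a1 \<noteq> a2" "a1 \<noteq> a3" using a1x by auto
  ultimately have "act a1 w0 \<noteq> w0" "act a2 w0 \<noteq> w0" "act a3 w0 \<noteq> w0" "act a1 w0 \<noteq> act a2 w0" "act a1 w0 \<noteq> act a3 w0"
    using faithful_off_I5[OF off(1,4)] faithful_off_I5[OF off(2,4)] faithful_off_I5[OF off(3,4)]
      faithful_off_I5[OF off(1,2)] faithful_off_I5[OF off(1,3)] a2(2) act_id[OF w0] by auto
  then obtain g where g: "g \<in> G" "act g w0 = w0" "act g (act a1 w0) = act a1 w0" "act g (act a2 w0) = act a3 w0"
    using transitive3[of w0 "act a1 w0" "act a2 w0" w0 "act a1 w0" "act a3 w0" thesis] w0 aG by force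
  have ginv: "act (inv g) w0 = w0" using act_inv_act[OF g(1) w0] g(2) by simp
  \<comment> \<open>\<open>u\<close> and \<open>v\<close> measure how far \<open>g\<close> is from
    conjugating \<open>a1\<close> to \<open>a1\<close> and \<open>a2\<close> to \<open>a3\<close>.
    When one of them is nontrivial, the aim is a point whose preimage under \<open>g\<close> is
    moved by both \<open>a1\<close> and \<open>a2\<close>, against disjointness of supports.\<close>
  define u where "u = inv a1 \<circ> (g \<circ> a1 \<circ> inv g)"
  define v where "v = inv a3 \<circ> (g \<circ> a2 \<circ> inv g)"
  have u: "u \<in> pstab w0" and v: "v \<in> pstab w0"
    unfolding u_def v_def using w0 g aG ginv by (simp_all add: pstab_def act_comp)
  have u_moves: "a1 (inv g z) \<noteq> inv g z" if "u z \<noteq> z" "a1 z = z" for z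
    using that g(1) aG inv_apply[OF aG(1), of z] by (auto simp: u_def)
  have v_moves: "a2 (inv g z) \<noteq> inv g z" if "v z \<noteq> z" "a3 z = z" for z
    using that g(1) aG inv_apply[OF aG(3), of z] by (auto simp: v_def)
  have u_id: "inv g (a1 z) = a1 (inv g z)" if "u = id" for z
  proof -
    have "a1 (u z) = a1 z" using that by simp
    then have "g (a1 (inv g z)) = a1 z" using aG by (simp add: u_def)
    then show ?thesis using inv_apply[OF g(1)] by metis
  qed
  have v_id: "inv g (a3 z) = a2 (inv g z)" if "v = id" for z
  proof -
    have "a3 (v z) = a3 z" using that by simp
    then have "g (a2 (inv g z)) = a3 z" using aG by (simp add: v_def)
    then show ?thesis using inv_apply[OF g(1)] by metis
  qed
  have moved: "a1 z \<noteq> z \<Longrightarrow> a2 z = z" for z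
    using rist_fix[OF a1, of z] rist_fix[OF a2(1), of z] disj by blast
  consider "u = id" "v = id" | "u = id" "v \<noteq> id" | "u \<noteq> id" "v = id" | "u \<noteq> id" "v \<noteq> id" by blast
  then show False
  proof cases
    case 1
    have comm: "a1 \<circ> a2 = a2 \<circ> a1"
      using a1 a2(1) disj by (intro rist_commute) blast+
    have a13: "a1 (a3 z) = a3 (a1 z)" for z
    proof -
      have "inv g (a1 (a3 z)) = a1 (a2 (inv g z))" using 1 u_id v_id by simp
      also have "\<dots> = a2 (a1 (inv g z))" using comm by (metis comp_apply)
      also have "\<dots> = inv g (a3 (a1 z))" using 1 u_id v_id by simp
      finally show ?thesis using g(1) by (metis apply_inv)
    qed
    have "b (b' z) = b' (b z)" for z
    proof (cases "z \<in> I1")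
      case True
      moreover from this have "b z \<in> I1" "b' z \<in> I1"
        using rist_mem_iff[OF b(1)] rist_mem_iff[OF b(2)] by auto
      ultimately show ?thesis using a13[of z] a1_I1 a3_I1 by simp
    next
      case False
      then show ?thesis using rist_fix[OF b(1), of z] rist_fix[OF b(2), of z] by simp
    qed
    then show False using b(3) by (simp add: fun_eq_iff)
  next
    case 2
    obtain z where z: "z \<in> S1" "d z \<noteq> z" "v z \<noteq> z"
      using dense[OF v 2(2) moved_open[OF dG(1)]] x by blast
    then have "z \<in> I2" using rist_fix[OF d(1), of z] by blast
    then have "a3 z = z" "a1 z \<noteq> z" using rist_fix[OF a3, of z] off_I2[of z] a1_I2[of z] z by auto
    then have "a2 (inv g z) \<noteq> inv g z" "a1 (inv g z) \<noteq> inv g z"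
      using v_moves[OF z(3)] u_id[OF 2(1), of z] apply_inv[OF g(1)] by metis+
    then show False using moved by blast
  next
    case 3
    obtain z where z: "z \<in> S1" "d' z \<noteq> z" "u z \<noteq> z"
      using dense[OF u 3(1) moved_open[OF dG(2)]] x' by blast
    then have "z \<in> I3" using rist_fix[OF d'(1), of z] by blast
    then have "a1 z = z" "a3 z \<noteq> z" using rist_fix[OF a1, of z] off_I3[of z] a3_I3[of z] z by auto
    then have "a1 (inv g z) \<noteq> inv g z" "a2 (inv g z) \<noteq> inv g z"
      using u_moves[OF z(3)] v_id[OF 3(2), of z] apply_inv[OF g(1)] by metis+
    then show False using moved by blast
  next
    case 4
    have fixed: "a1 z = z" "a3 z = z" if "z \<in> I5" for z
      using rist_fix[OF a1, of z] rist_fix[OF a3, of z] off_I5[OF that] by auto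
    obtain z where z: "z \<in> I5" "u z \<noteq> z" using dense[OF u 4(1) op(5) ne(5)] by blast
    \<comment> \<open>A single point of \<open>I5\<close> has to serve both: the conjugate of
      \<open>a1\<close> by \<open>g\<close> moves all of \<open>?V\<close>, and \<open>v\<close>
      moves some point of it.\<close>
    let ?V = "I5 \<inter> {z \<in> S1. (g \<circ> a1 \<circ> inv g) z \<noteq> z}"
    have "open_S1 ?V" using op(5) moved_open[of "g \<circ> a1 \<circ> inv g"] g(1) aG(1) by (intro openin_Int) auto
    moreover have "(g \<circ> a1 \<circ> inv g) z \<noteq> z"
      using u_moves[OF z(2)] fixed z(1) g(1) by (metis comp_apply inv_apply)
    then have "?V \<noteq> {}" using z(1) I(5) carc_subset_S1 by blast
    ultimately obtain y where y: "y \<in> I5" "(g \<circ> a1 \<circ> inv g) y \<noteq> y" "v y \<noteq> y"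
      using dense[OF v 4(2)] by blast
    have "a1 (inv g y) \<noteq> inv g y" using y(2) g(1) by auto
    moreover have "a2 (inv g y) \<noteq> inv g y" using v_moves y fixed by blast
    ultimately show False using moved by blast
  qed
qed

text \<open>Testing triviality on one closed arc decides whether the two arcs are placed at its ends
  inside it or just beyond them. Every set between the closed outer arc and the larger open one then
  has the same triviality at \<open>w\<close>.\<close>

lemma homogeneous_arcs:
  assumes "p < q"
  obtains A1 B1 A2 B2 where "p < A1" "A1 < B1" "B1 < A2" "A2 < B2" "B2 < q"
    "triv (carc A2 (B1 + 2 * pi)) w \<or> \<not> triv (cis ` {B2..A1 + 2 * pi}) w"
proof -
  \<comment> \<open>Six equidistant cut points; the second and the fifth bound the tested
    arc.\<close>
  define e where "e = (q - p) / 7"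
  have e: "e > 0" "q = p + 7 * e" using assms by (auto simp: e_def field_simps)
  define x y where "x = p + 2 * e" "y = p + 5 * e"
  show ?thesis
  proof (cases "triv (cis ` {y..x + 2 * pi}) w")
    case True
    then have "triv (carc y (x + 2 * pi)) w"
      by (rule triv_mono) (auto simp: carc_def)
    then show ?thesis using e that[of "p + e" x y "p + 6 * e"] by (simp add: x_y_def)
  next
    case False
    then show ?thesis using e that[of x "p + 3 * e" "p + 4 * e" y] by (simp add: x_y_def)
  qed
qed

text \<open>\<open>c\<close> preserves every set that contains \<open>J\<close> or misses it, and
  triviality is equivariant.\<close>

lemma triv_differs_cut:
  assumes "c \<in> rist J" "w \<in> \<Omega>" "triv U w \<noteq> triv U (act c w)"
  shows "\<exists>j\<in>J. j \<notin> U" "\<exists>j\<in>J. j \<in> U"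
proof -
  have "c ` U \<noteq> U" using triv_image[OF rist_G[OF assms(1)] assms(2), of U] assms(3) by auto
  then have "\<not> (J \<subseteq> U \<or> J \<inter> U = {})" using rist_image[OF assms(1)] by blast
  then show "\<exists>j\<in>J. j \<notin> U" "\<exists>j\<in>J. j \<in> U" by blast+
qed

text \<open>For \<^term>\<open>c\<close> in \<^term>\<open>rist J\<close>, the points \<^term>\<open>w\<close> and \<^term>\<open>act c w\<close> disagree only on connected
  sets that cut \<^term>\<open>J\<close>. A set cutting both of two homogeneous arcs is either contained in the arc
  around them, where everything is trivial, or has the triviality of the outer arc, as do its
  images. Hence the three-point argument applies.\<close>
lemma triv_spreads:
  assumes w0: "w0 \<in> \<Omega>" and I: "open_S1 I" "I \<noteq> {}" "triv I w0" and K: "narrow K"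
  shows "triv K w0"
proof -
  obtain p q where pq: "p < q" "q < p + 2 * pi" "carc p q \<subseteq> I"
    using carc_inside[OF I(1,2), of "2 * pi"] pi_gt_zero by (metis mult_pos_pos zero_less_numeral)
  have triv_pq: "triv (carc p q) w0" using triv_mono[OF I(3) pq(3)] .
  obtain A1 B1 A2 B2 where A: "p < A1" "A1 < B1" "B1 < A2" "A2 < B2" "B2 < q"
    and hom: "triv (carc A2 (B1 + 2 * pi)) w0 \<or> \<not> triv (cis ` {B2..A1 + 2 * pi}) w0"
    using homogeneous_arcs[OF pq(1)] by metis
  define J1 J2 where J: "J1 = carc A1 B1" "J2 = carc A2 B2"
  have "open_S1 J1" "open_S1 J2" unfolding J using A pq by (intro open_carc; linarith)+
  moreover have "J1 \<noteq> {}" "J2 \<noteq> {}" unfolding J using A by (intro carc_nonempty; linarith)+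
  ultimately obtain c1 c2 where c1: "c1 \<in> rist J1" "c1 \<noteq> id" and c2: "c2 \<in> rist J2" "c2 \<noteq> id"
    using rist_nontrivial by metis
  have cG: "c1 \<in> G" "c2 \<in> G" using c1 c2 rist_G by auto
  have J_sub: "J1 \<subseteq> carc p q" "J2 \<subseteq> carc p q" unfolding J using A by (intro carc_mono; linarith)+
  have c_pq: "c1 \<in> rist (carc p q)" "c2 \<in> rist (carc p q)" using c1 c2 J_sub rist_mono by blast+
  have J_disj: "J1 \<inter> J2 = {}" unfolding J using A pq by (intro carc_disjoint; linarith)
  have c12: "c1 \<noteq> c2"
  proof
    assume "c1 = c2"
    then have "c1 z = z" for z using rist_fix[OF c1(1), of z] rist_fix[OF c2(1), of z] J_disj by blast
    then show False using c1(2) by auto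
  qed
  \<comment> \<open>Triviality on \<open>carc p q\<close> lets the image of \<open>w0\<close>
    distinguish elements supported there; this makes the triple distinct.\<close>
  have inj: "f = h" if "f \<in> rist (carc p q)" "h \<in> rist (carc p q)" "act f w0 = act h w0" for f h
  proof -
    have G: "f \<in> G" "h \<in> G" using that rist_G by auto
    have "inv h \<circ> f \<in> rist (carc p q) \<inter> pstab w0"
      using that pstab_comp_inv[OF w0 G that(3)] rist_comp rist_inv by blast
    then have "inv h \<circ> f = id" using triv_pq unfolding triv_def by blast
    then have "h \<circ> (inv h \<circ> f) = h \<circ> id" by simp
    then show ?thesis using G by (simp add: fun_eq_iff)
  qed
  define w1 w2 where w: "w1 = act c1 w0" "w2 = act c2 w0"
  have w_mem: "w1 \<in> \<Omega>" "w2 \<in> \<Omega>" using w0 cG by (auto simp: w)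
  have w_ne: "w0 \<noteq> w1" "w0 \<noteq> w2" "w1 \<noteq> w2"
    using inj[of id c1] inj[of id c2] inj[of c1 c2] c1 c2 c12 c_pq w0 by (auto simp: w)
  define D where "D = (\<lambda>w w' U. connected U \<and> U \<subseteq> S1 \<and> triv U w \<noteq> triv U w')"
  have disj: "\<not> (D w0 w1 U \<and> D w0 w2 U)" for U
  proof
    assume D: "D w0 w1 U \<and> D w0 w2 U"
    then have U: "connected U" "U \<subseteq> S1" and ne: "triv U w0 \<noteq> triv U w1" "triv U w0 \<noteq> triv U w2"
      by (auto simp: D_def)
    obtain s1 where s1: "A1 < s1" "s1 < B1" "cis s1 \<notin> U"
      using triv_differs_cut(1)[OF c1(1) w0, of U] ne(1) by (auto simp: J carc_def w)
    obtain u1 where u1: "A1 < u1" "u1 < B1" "cis u1 \<in> U"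
      using triv_differs_cut(2)[OF c1(1) w0, of U] ne(1) by (auto simp: J carc_def w)
    obtain s2 where s2: "A2 < s2" "s2 < B2" "cis s2 \<notin> U"
      using triv_differs_cut(1)[OF c2(1) w0, of U] ne(2) by (auto simp: J carc_def w)
    obtain u2 where u2: "A2 < u2" "u2 < B2" "cis u2 \<in> U"
      using triv_differs_cut(2)[OF c2(1) w0, of U] ne(2) by (auto simp: J carc_def w)
    have shift: "triv U w1 \<longleftrightarrow> triv (inv c1 ` U) w0"
      using triv_image[OF cG(1) w0, of "inv c1 ` U"] cG by (simp add: w)
    have inv_image: "inv c1 ` U \<subseteq> M" if "U \<subseteq> M" "J1 \<subseteq> M" for M
      using image_mono[OF that(1), of "inv c1"] rist_image[OF rist_inv[OF c1(1)], of M] that(2) by simp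
    have "U \<subseteq> carc A1 B2 \<or> (cis ` {B2..A1 + 2 * pi} \<subseteq> U \<and> U \<subseteq> carc A2 (B1 + 2 * pi))"
      using connected_between_arcs[OF U A(2,3,4) _ s1 u1 s2 u2] A pq by simp
    then show False
    proof
      assume "U \<subseteq> carc A1 B2"
      moreover have "carc A1 B2 \<subseteq> carc p q" using A by (intro carc_mono) linarith+
      ultimately have "U \<subseteq> carc p q" by blast
      then have "triv U w0" "triv (inv c1 ` U) w0"
        using triv_pq triv_mono inv_image J_sub(1) by blast+
      then show False using ne(1) shift by simp
    next
      assume U_outer: "cis ` {B2..A1 + 2 * pi} \<subseteq> U \<and> U \<subseteq> carc A2 (B1 + 2 * pi)"
      have "cis t \<in> inv c1 ` U" if "t \<in> {B2..A1 + 2 * pi}" for t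
      proof -
        have "cis t \<notin> J1"
          unfolding J using that A cis_notin_carc[of "t - 2 * pi" A1 B1] by simp
        then have "inv c1 (cis t) = cis t" using rist_fix[OF rist_inv[OF c1(1)]] by blast
        moreover have "cis t \<in> U" using U_outer that by blast
        ultimately show ?thesis by (metis imageI)
      qed
      then have outer': "cis ` {B2..A1 + 2 * pi} \<subseteq> inv c1 ` U" by blast
      have "cis t \<in> carc A2 (B1 + 2 * pi)" if "A1 < t" "t < B1" for t
      proof -
        have "cis (t + 2 * pi) \<in> carc A2 (B1 + 2 * pi)"
          using that A pq by (intro carcI) linarith+
        then show ?thesis by simp
      qed
      then have "J1 \<subseteq> carc A2 (B1 + 2 * pi)" unfolding J by (auto simp: carc_def)
      then have "inv c1 ` U \<subseteq> carc A2 (B1 + 2 * pi)" using inv_image U_outer by blast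
      then have "triv U w0 \<longleftrightarrow> triv (inv c1 ` U) w0"
        using hom triv_mono outer' U_outer by metis
      then show False using ne(1) shift by simp
    qed
  qed
  have none: "\<not> D v1 v2 U" if "v1 \<in> \<Omega>" "v2 \<in> \<Omega>" "v1 \<noteq> v2" for v1 v2 U
  proof (rule three_point[where D = D, OF _ _ _ w0 w_mem w_ne])
    show "D (act g w) (act g w') (g ` V)" if "g \<in> G" "w \<in> \<Omega>" "w' \<in> \<Omega>" "D w w' V" for g w w' V
      using that connected_image image_subset_S1 by (simp add: D_def triv_image)
  qed (use disj that in \<open>auto simp: D_def\<close>)
  \<comment> \<open>Triviality on connected sets no longer depends on the point, so compressing
    \<open>carc a b\<close> into \<open>carc p q\<close> is harmless even if \<open>g\<close> moves
    \<open>w0\<close>.\<close>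
  obtain a b where ab: "a < b" "b < a + 2 * pi" "K \<subseteq> carc a b" using narrow_in_carc[OF K] by blast
  obtain g where g: "g \<in> G" "g ` carc a b \<subseteq> carc p q"
    using compress[OF narrow_carc[OF ab(2)], of "carc p q"] open_carc[of q p] carc_nonempty[OF pq(1)] pq by auto
  have "triv (g ` carc a b) (act g (act (inv g) w0))"
    using triv_mono[OF triv_pq g(2)] g(1) w0 by simp
  then have "triv (carc a b) (act (inv g) w0)"
    using triv_image[OF g(1), of "act (inv g) w0"] g(1) w0 by simp
  then have "triv (carc a b) w0"
    using none[of w0 "act (inv g) w0" "carc a b"] w0 g(1) connected_carc carc_subset_S1
    by (cases "w0 = act (inv g) w0") (auto simp: D_def)
  then show ?thesis using triv_mono ab(3) by blast
qed

lemma rist_pstab_nontrivial: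
  assumes "w0 \<in> \<Omega>" "open_S1 V" "V \<noteq> {}"
  shows "\<exists>s\<in>rist V. s \<in> pstab w0 \<and> s \<noteq> id"
proof (rule ccontr)
  assume "\<not> ?thesis"
  then have "triv V w0" unfolding triv_def by blast
  then show False using not_all_triv[OF assms(1)] triv_spreads[OF assms] by blast
qed

end

section \<open>Point stabilizers acting minimally on the circle\<close>

context triple_action
begin

text \<open>The negation says that \<open>pstab w\<close> and \<open>pstab w'\<close> meet
  \<open>rist U\<close> in the same set. For fixed \<open>U\<close> this is an equivalence relation
  in the points, which is the source of \<open>bad_ultra\<close>.\<close>

definition bad :: "complex set \<Rightarrow> 'b \<Rightarrow> 'b \<Rightarrow> bool" where
  "bad U w w' \<longleftrightarrow> (\<exists>s\<in>rist U. (act s w = w) \<noteq> (act s w' = w'))"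

lemma bad_mono: "bad U w w' \<Longrightarrow> U \<subseteq> V \<Longrightarrow> bad V w w'"
  unfolding bad_def using rist_mono by blast

lemma bad_sym: "bad U w w' \<Longrightarrow> bad U w' w"
  unfolding bad_def by blast

lemma bad_irrefl: "\<not> bad U w w"
  unfolding bad_def by blast

lemma bad_ultra: "bad U w1 w2 \<Longrightarrow> bad U w0 w1 \<or> bad U w0 w2"
  unfolding bad_def by blast

lemma bad_image:
  assumes "g \<in> G" "w \<in> \<Omega>" "w' \<in> \<Omega>" "bad U w w'"
  shows "bad (g ` U) (act g w) (act g w')"
proof -
  obtain s where s: "s \<in> rist U" "(act s w = w) \<noteq> (act s w' = w')" using assms(4) by (auto simp: bad_def)
  have sG: "s \<in> G" using s rist_G by blast
  have "act (g \<circ> s \<circ> inv g) (act g v) = act g v \<longleftrightarrow> act s v = v" if "v \<in> \<Omega>" for v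
    using that assms(1) sG by (simp add: act_comp act_inj)
  then show ?thesis
    unfolding bad_def using rist_conj[OF assms(1) s(1)] s(2) assms(2,3) by (intro bexI[of _ "g \<circ> s \<circ> inv g"]) auto
qed

text \<open>\<open>c\<close> commutes with \<open>rist U\<close>, so \<open>w'\<close> and
  \<open>act c w'\<close> have the same stabilizer in it.\<close>

lemma bad_disjoint_rist:
  assumes "c \<in> rist V" "U \<inter> V = {}" "w \<in> \<Omega>" "w' \<in> \<Omega>"
  shows "bad U w (act c w') \<longleftrightarrow> bad U w w'"
proof -
  have cG: "c \<in> G" using assms rist_G by blast
  have "act s (act c w') = act c w' \<longleftrightarrow> act s w' = w'" if "s \<in> rist U" for s
  proof -
    have sG: "s \<in> G" using that rist_G by blast
    have "act s (act c w') = act (s \<circ> c) w'" using act_comp sG cG assms(4) by simp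
    also have "\<dots> = act (c \<circ> s) w'" using rist_commute[OF that assms(1,2)] by simp
    also have "\<dots> = act c (act s w')" using act_comp sG cG assms(4) by simp
    finally show ?thesis using act_inj[OF cG] sG assms(4) by simp
  qed
  then show ?thesis unfolding bad_def by auto
qed

lemma conj_in_pstab_trivial:
  assumes "w0 \<in> \<Omega>" "s \<in> G" "\<And>g. g \<in> G \<Longrightarrow> g \<circ> s \<circ> inv g \<in> pstab w0"
  shows "s = id"
proof (rule act_eq_imp_eq)
  fix w assume w: "w \<in> \<Omega>"
  obtain g where g: "g \<in> G" "act g w = w0" using transitive1[OF w assms(1)] by blast
  then have "s \<in> pstab w" using assms(3)[OF g(1)] pstab_conj[OF w g(1) assms(2)] by simp
  then show "act s w = act id w" using w by (simp add: pstab_def)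
qed (use assms in auto)

end

text \<open>The case of a point stabilizer acting minimally on the circle, which turns out to be
  impossible.\<close>
locale minimal_stabilizer = triple_action G \<Omega> act
  for G and \<Omega> :: "'b set" and act +
  fixes w0 :: 'b
  assumes w0 [simp]: "w0 \<in> \<Omega>"
    and stab_minimal: "\<And>x V. x \<in> S1 \<Longrightarrow> open_S1 V \<Longrightarrow> V \<noteq> {} \<Longrightarrow> \<exists>h\<in>pstab w0. h x \<in> V"
begin

text \<open>\<open>contraction\<close> is applied to the group \<open>pstab w0\<close> itself, whose
  rigid stabilizers are nontrivial by \<open>rist_pstab_nontrivial\<close>. Unlike with
  \<open>compress\<close>, the compressing element does not move \<open>w0\<close>.\<close>

lemma pstab_compress:
  assumes "narrow K" "open_S1 V" "V \<noteq> {}"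
  obtains h where "h \<in> pstab w0" "h ` K \<subseteq> V"
proof -
  interpret H: homeo_group "pstab w0" by (rule homeo_group_pstab) simp
  have rist: "\<exists>s\<in>H.rist W. s \<noteq> id" if W: "open_S1 W" "W \<noteq> {}" for W
  proof -
    obtain s where s: "s \<in> rist W" "s \<in> pstab w0" "s \<noteq> id"
      using rist_pstab_nontrivial[OF w0 W] by blast
    then have "s \<in> H.rist W" using rist_fix[OF s(1)] by (simp add: H.rist_def)
    then show ?thesis using s(3) by blast
  qed
  show ?thesis using H.contraction[OF stab_minimal rist assms] that by blast
qed

lemma pstab_conj_iff:
  assumes "h \<in> pstab w0" "s \<in> G"
  shows "h \<circ> s \<circ> inv h \<in> pstab w0 \<longleftrightarrow> s \<in> pstab w0"
  using pstab_conj[OF w0 pstab_G[OF assms(1)] assms(2)] pstab_act[OF assms(1)] by simp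

text \<open>Otherwise conjugation by compressing elements of \<open>pstab w0\<close> would put every
  element of narrow support into \<open>pstab w0\<close>; a nontrivial one with all its conjugates
  there contradicts faithfulness.\<close>

lemma rist_not_subset:
  assumes V: "open_S1 V" "V \<noteq> {}"
  obtains c where "c \<in> rist V" "c \<notin> pstab w0"
proof (rule ccontr)
  assume "\<not> thesis"
  then have sub: "rist V \<subseteq> pstab w0" using that by blast
  have all: "s \<in> pstab w0" if K: "narrow K" and s: "s \<in> rist K" for K s
  proof -
    obtain h where h: "h \<in> pstab w0" "h ` K \<subseteq> V" using pstab_compress[OF K V] by blast
    have "h \<circ> s \<circ> inv h \<in> rist V"
      using rist_mono[OF rist_conj[OF pstab_G[OF h(1)] s] h(2)] .
    then show ?thesis using sub pstab_conj_iff[OF h(1) rist_G[OF s]] by blast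
  qed
  define K where "K = carc 0 1"
  have K: "narrow K" "open_S1 K" "K \<noteq> {}"
    unfolding K_def using pi_gt3 narrow_carc[of 1 0] open_carc[of 1 0] carc_nonempty[of 0 1] by auto
  obtain s where s: "s \<in> rist K" "s \<noteq> id" using rist_nontrivial[OF K(2,3)] by blast
  have "g \<circ> s \<circ> inv g \<in> pstab w0" if "g \<in> G" for g
    using all[OF narrow_image[OF that K(1)] rist_conj[OF that s(1)]] .
  then show False using conj_in_pstab_trivial[OF w0 rist_G[OF s(1)]] s(2) by blast
qed

text \<open>If \<^term>\<open>pstab w0\<close> met the rigid stabilizer of an arc in a normal subgroup, the double
  commutator trick would put the commutators of elements with small support into it; conjugating
  these around contradicts faithfulness.\<close>
lemma not_normalized:
  assumes K: "open_S1 K" "K \<noteq> {}"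
  obtains s c where "s \<in> rist K" "s \<in> pstab w0" "c \<in> rist K" "c \<circ> s \<circ> inv c \<notin> pstab w0"
proof (rule ccontr)
  assume "\<not> thesis"
  then have normal: "\<And>s c. s \<in> rist K \<Longrightarrow> s \<in> pstab w0 \<Longrightarrow> c \<in> rist K \<Longrightarrow> c \<circ> s \<circ> inv c \<in> pstab w0"
    using that by blast
  interpret H: homeo_group "pstab w0" by (rule homeo_group_pstab) simp
  obtain n where n: "n \<in> rist K" "n \<in> pstab w0" "n \<noteq> id"
    using rist_pstab_nontrivial[OF w0 K] by blast
  have nG: "n \<in> G" using n pstab_G by blast
  obtain x where "n x \<noteq> x" using nontrivial_moves[OF nG n(3)] by blast
  moreover from this have "x \<in> K" using rist_fix[OF n(1)] by blast
  ultimately obtain I where I: "open_S1 I" "x \<in> I" "I \<subseteq> K" "n ` I \<inter> I = {}"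
    using displaced_nbhd[OF nG _ _ K(1)] by blast
  \<comment> \<open>Here \<open>t\<close> is the commutator \<open>a^-1 b a b^-1\<close>, given by a
    relation that is easy to conjugate.\<close>
  have comm_I: "t \<in> pstab w0"
    if a: "a \<in> rist I" and b: "b \<in> rist I" and t: "t \<in> G" "\<And>z. b (a z) = a (t (b z))" for a b t
  proof -
    have aK: "a \<in> rist K" and bK: "b \<in> rist K" using a b I(3) rist_mono by blast+
    have G: "a \<in> G" "b \<in> G" using a b rist_G by auto
    define a' where "a' = n \<circ> a \<circ> inv n"
    have a': "a' \<in> rist (n ` I)" unfolding a'_def by (rule rist_conj[OF nG a])
    have a'G: "a' \<in> G" using a' rist_G by blast
    \<comment> \<open>\<open>m\<close> is the commutator of \<open>n\<close> and \<open>a\<close>,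
      equal to \<open>a' a^-1\<close>. As \<open>a'\<close> is supported off \<open>I\<close>, the
      commutator of \<open>m\<close> with \<open>b\<close> only sees \<open>a^-1\<close> and equals
      \<open>t\<close>; normality keeps both commutators in \<open>pstab w0\<close>.\<close>
    define m where "m = n \<circ> (a \<circ> inv n \<circ> inv a)"
    have m_H: "m \<in> pstab w0"
      unfolding m_def by (intro H.comp_mem n normal rist_inv H.inv_mem aK)
    have m_K: "m \<in> rist K"
      unfolding m_def by (intro rist_comp rist_inv n aK)
    have mG: "m \<in> G" using m_H pstab_G by blast
    have "m \<circ> (b \<circ> inv m \<circ> inv b) \<in> pstab w0"
      by (intro H.comp_mem m_H normal rist_inv H.inv_mem m_K bK)
    moreover have "m \<circ> (b \<circ> inv m \<circ> inv b) = t"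
    proof
      fix z
      have m: "m y = a' (inv a y)" for y by (simp add: m_def a'_def)
      have inv_m: "inv m y = a (inv a' y)" for y
      proof -
        have "m (a (inv a' y)) = y" using G a'G by (simp add: m)
        then show ?thesis using inv_apply[OF mG] by metis
      qed
      have c: "inv a \<circ> b \<circ> a \<in> rist I" using a b by (intro rist_comp rist_inv)
      have "I \<inter> n ` I = {}" using I(4) by blast
      then have "(inv a \<circ> b \<circ> a) \<circ> inv a' = inv a' \<circ> (inv a \<circ> b \<circ> a)"
        by (rule rist_commute[OF c rist_inv[OF a']])
      then have commute: "inv a (b (a (inv a' y))) = inv a' (inv a (b (a y)))" for y
        by (metis comp_apply)
      have "(m \<circ> (b \<circ> inv m \<circ> inv b)) z = a' (inv a (b (a (inv a' (inv b z)))))"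
        by (simp add: m inv_m)
      also have "\<dots> = inv a (b (a (inv b z)))" using commute a'G by simp
      also have "\<dots> = t z" using t(2)[of "inv b z"] G by simp
      finally show "(m \<circ> (b \<circ> inv m \<circ> inv b)) z = t z" .
    qed
    ultimately show ?thesis by simp
  qed
  have comm: "t \<in> pstab w0"
    if L: "narrow L" and a: "a \<in> rist L" and b: "b \<in> rist L" and t: "t \<in> G" "\<And>z. b (a z) = a (t (b z))" for a b t L
  proof -
    obtain h where h: "h \<in> pstab w0" "h ` L \<subseteq> I" using pstab_compress[OF L I(1)] I(2) by blast
    have hG: "h \<in> G" using h pstab_G by blast
    have "h \<circ> t \<circ> inv h \<in> pstab w0"
    proof (rule comm_I)
      show "h \<circ> a \<circ> inv h \<in> rist I" "h \<circ> b \<circ> inv h \<in> rist I"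
        using rist_conj[OF hG a] rist_conj[OF hG b] rist_mono h(2) by blast+
      show "h \<circ> t \<circ> inv h \<in> G" using hG t(1) by simp
    qed (use hG t(2) in simp)
    then show ?thesis using pstab_conj_iff[OF h(1) t(1)] by simp
  qed
  define L where "L = carc 0 1"
  have L: "narrow L" "open_S1 L" "L \<noteq> {}"
    unfolding L_def using pi_gt3 narrow_carc[of 1 0] open_carc[of 1 0] carc_nonempty[of 0 1] by auto
  obtain a b where ab: "a \<in> rist L" "b \<in> rist L" "a \<circ> b \<noteq> b \<circ> a"
    using rist_noncommuting[OF L(2,3)] by blast
  have G: "a \<in> G" "b \<in> G" using ab rist_G by auto
  define t where "t = inv a \<circ> b \<circ> a \<circ> inv b"
  have tG: "t \<in> G" unfolding t_def using G by simp
  have t: "b (a z) = a (t (b z))" for z unfolding t_def using G by simp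
  have "t = id"
  proof (rule conj_in_pstab_trivial[OF w0 tG])
    fix g assume g: "g \<in> G"
    show "g \<circ> t \<circ> inv g \<in> pstab w0"
    proof (rule comm[OF narrow_image[OF g L(1)] rist_conj[OF g ab(1)] rist_conj[OF g ab(2)]])
      show "g \<circ> t \<circ> inv g \<in> G" using g tG by simp
    qed (use g t in simp)
  qed
  then have "b (a z) = a (b z)" for z using t by simp
  then show False using ab(3) by (simp add: fun_eq_iff)
qed

text \<open>The three-point argument on germs: \<open>D\<close> records, as singletons, the points
  all of whose neighbourhoods are bad. For \<open>w0\<close> and its image under an element of
  \<open>rist J\<close> they lie in the closure of \<open>J\<close>, so two arcs with disjoint
  closures give the required disjointness.\<close>

lemma good_nbhd:
  assumes v: "v \<in> \<Omega>" "v \<noteq> w0" and x: "x \<in> S1"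
  obtains V where "open_S1 V" "x \<in> V" "\<not> bad V w0 v"
proof -
  define D where "D = (\<lambda>w w' U. \<exists>y\<in>S1. U = {y} \<and> (\<forall>V. open_S1 V \<longrightarrow> y \<in> V \<longrightarrow> bad V w w'))"
  have equivariant: "D (act g w) (act g w') (g ` U)"
    if g: "g \<in> G" and w: "w \<in> \<Omega>" "w' \<in> \<Omega>" and D: "D w w' U" for g w w' U
  proof -
    obtain y where y: "y \<in> S1" "U = {y}" "\<And>V. open_S1 V \<Longrightarrow> y \<in> V \<Longrightarrow> bad V w w'"
      using D unfolding D_def by blast
    have "bad V (act g w) (act g w')" if V: "open_S1 V" "g y \<in> V" for V
    proof -
      have "y \<in> inv g ` V" using imageI[OF V(2), of "inv g"] g by simp
      then have "bad (inv g ` V) w w'" using y(3) open_image[OF inv_mem[OF g] V(1)] by blast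
      then show ?thesis using bad_image[OF g w, of "inv g ` V"] g by simp
    qed
    then show ?thesis using y(1,2) g mem_S1_iff[OF g] unfolding D_def by (intro bexI[of _ "g y"]) auto
  qed
  have ultra: "D u0 u1 U \<or> D u0 u2 U" if D: "D u1 u2 U" for u0 u1 u2 U
  proof (rule ccontr)
    assume neg: "\<not> ?thesis"
    obtain y where y: "y \<in> S1" "U = {y}" "\<And>V. open_S1 V \<Longrightarrow> y \<in> V \<Longrightarrow> bad V u1 u2"
      using D unfolding D_def by blast
    obtain V1 where V1: "open_S1 V1" "y \<in> V1" "\<not> bad V1 u0 u1" using neg y(1,2) unfolding D_def by blast
    obtain V2 where V2: "open_S1 V2" "y \<in> V2" "\<not> bad V2 u0 u2" using neg y(1,2) unfolding D_def by blast
    have "bad (V1 \<inter> V2) u1 u2" using y(3) V1 V2 openin_Int by blast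
    then have "bad (V1 \<inter> V2) u0 u1 \<or> bad (V1 \<inter> V2) u0 u2" by (rule bad_ultra)
    then show False using V1(3) V2(3) bad_mono[of "V1 \<inter> V2"] by blast
  qed
  have sym: "D w' w U" if "D w w' U" for w w' U
    using that bad_sym unfolding D_def by blast
  have off: "\<not> bad V w0 (act c w0)" if "c \<in> rist J" "V \<inter> J = {}" for c V J
    using bad_disjoint_rist[OF that w0 w0] bad_irrefl by blast
  define J1 J2 where J: "J1 = carc 0 1" "J2 = carc 2 3"
  have "open_S1 J1" "open_S1 J2" "J1 \<noteq> {}" "J2 \<noteq> {}"
    unfolding J using pi_gt3 by (auto intro!: open_carc carc_nonempty)
  then obtain c1 c2 where c: "c1 \<in> rist J1" "c1 \<notin> pstab w0" "c2 \<in> rist J2" "c2 \<notin> pstab w0"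
    using rist_not_subset by metis
  have cG: "c1 \<in> G" "c2 \<in> G" using c rist_G by auto
  have c_mem: "act c1 w0 \<in> \<Omega>" "act c2 w0 \<in> \<Omega>" using cG by auto
  have c_ne: "w0 \<noteq> act c1 w0" "w0 \<noteq> act c2 w0" using c cG by (auto simp: pstab_def)
  define V1 V2 where V: "V1 = carc 1 (2 * pi)" "V2 = carc 3 (2 + 2 * pi)"
  have V_disj: "V1 \<inter> J1 = {}" "V2 \<inter> J2 = {}"
    using carc_disjoint[of 1 1 "2 * pi" 0] carc_disjoint[of 3 3 "2 + 2 * pi" 2] by (auto simp: V J)
  have V_open: "open_S1 V1" "open_S1 V2" unfolding V by (intro open_carc; simp)+
  have cover: "y \<in> V1 \<or> y \<in> V2" if y: "y \<in> S1" for y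
  proof -
    obtain t where t: "1 \<le> t" "t < 1 + 2 * pi" "y = cis t" using S1_cis_cases[OF y] by metis
    consider "t = 1" | "1 < t" "t < 2 * pi" | "2 * pi \<le> t" using t by linarith
    then show ?thesis
    proof cases
      case 1
      then have "cis (t + 2 * pi) \<in> V2" unfolding V using pi_gt3 by (intro carcI) auto
      then show ?thesis using t by simp
    next
      case 2
      then show ?thesis using carcI t by (simp add: V)
    next
      case 3
      then have "cis t \<in> V2" unfolding V using t pi_gt3 by (intro carcI) auto
      then show ?thesis using t by simp
    qed
  qed
  have disj: "\<not> (D w0 (act c1 w0) U \<and> D w0 (act c2 w0) U)" for U
    using cover V_open off[OF c(1) V_disj(1)] off[OF c(3) V_disj(2)] unfolding D_def by blast
  \<comment> \<open>\<open>three_point\<close> needs distinct points; if the two images coincide,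
    \<open>disj\<close> already empties the relation for that pair.\<close>
  have "\<not> D w0 v {x}"
  proof (cases "act c1 w0 = act c2 w0")
    case True
    obtain g where g: "g \<in> G" "act g w0 = w0" "act g v = act c1 w0"
      using transitive2[of w0 v w0 "act c1 w0"] v c_mem c_ne w0 by metis
    then show ?thesis using equivariant[of g w0 v "{x}"] v disj[of "g ` {x}"] True by auto
  next
    case False
    then show ?thesis
      using three_point[where D = D, OF equivariant sym ultra w0 c_mem c_ne False disj w0 v(1)] v(2) by blast
  qed
  then show ?thesis using that x unfolding D_def by blast
qed

text \<open>\<open>F\<close> consists of the endpoints of finitely many good arcs covering the
  circle: a connected set avoiding them lies inside any of these arcs that it meets.\<close>

lemma bad_meets_finite:
  assumes v: "v \<in> \<Omega>" "v \<noteq> w0"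
  obtains F where "finite F" "\<And>U. connected U \<Longrightarrow> U \<subseteq> S1 \<Longrightarrow> U \<noteq> {} \<Longrightarrow> bad U w0 v \<Longrightarrow> U \<inter> F \<noteq> {}"
proof -
  define \<C> where "\<C> = {carc (t - e) (t + e) |t e. 0 < e \<and> e < pi \<and> \<not> bad (carc (t - e) (t + e)) w0 v}"
  have "open_S1 c" if "c \<in> \<C>" for c
    using that unfolding \<C>_def by (auto intro!: open_carc)
  moreover have "S1 \<subseteq> \<Union>\<C>"
  proof
    fix x assume x: "x \<in> S1"
    then obtain t where t: "x = cis t" using S1_cis_cases by metis
    obtain V where V: "open_S1 V" "x \<in> V" "\<not> bad V w0 v" using good_nbhd[OF v x] by blast
    obtain e where e: "0 < e" "e < pi" "carc (t - e) (t + e) \<subseteq> V"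
      using carc_nbhd[OF V(1), of t pi] V(2) t pi_gt_zero by blast
    then have "\<not> bad (carc (t - e) (t + e)) w0 v" using V(3) bad_mono by blast
    moreover have "x \<in> carc (t - e) (t + e)" unfolding t using e by (intro carcI) auto
    ultimately show "x \<in> \<Union>\<C>" unfolding \<C>_def using e by blast
  qed
  moreover have "compact S1" by simp
  ultimately obtain \<D> where \<D>: "\<D> \<subseteq> \<C>" "finite \<D>" "S1 \<subseteq> \<Union>\<D>"
    unfolding compact_eq_openin_cover by metis
  have "\<exists>E. finite E \<and> (\<forall>U. connected U \<longrightarrow> U \<subseteq> S1 \<longrightarrow> U \<inter> c \<noteq> {} \<longrightarrow> U \<inter> E = {} \<longrightarrow> \<not> bad U w0 v)" if c: "c \<in> \<D>" for c
  proof -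
    obtain t e where te: "c = carc (t - e) (t + e)" "0 < e" "e < pi" "\<not> bad c w0 v"
      using c \<D>(1) unfolding \<C>_def by blast
    have "\<not> bad U w0 v" if U: "connected U" "U \<subseteq> S1" "U \<inter> c \<noteq> {}" "U \<inter> {cis (t - e), cis (t + e)} = {}" for U
    proof -
      have "U \<subseteq> c \<or> U \<subseteq> carc (t + e) (t - e + 2 * pi)"
        unfolding te(1) using U te by (intro connected_in_carc) auto
      moreover have "c \<inter> carc (t + e) (t - e + 2 * pi) = {}"
        unfolding te(1) by (rule carc_disjoint) auto
      ultimately have "U \<subseteq> c" using U(3) by blast
      then show ?thesis using te(4) bad_mono by blast
    qed
    then show ?thesis by (intro exI[of _ "{cis (t - e), cis (t + e)}"]) blast
  qed
  then obtain E where E: "\<And>c. c \<in> \<D> \<Longrightarrow> finite (E c)"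
    "\<And>c U. c \<in> \<D> \<Longrightarrow> connected U \<Longrightarrow> U \<subseteq> S1 \<Longrightarrow> U \<inter> c \<noteq> {} \<Longrightarrow> U \<inter> E c = {} \<Longrightarrow> \<not> bad U w0 v"
    by metis
  show ?thesis
  proof
    show "finite (\<Union>c\<in>\<D>. E c)" using \<D>(2) E(1) by blast
    fix U assume U: "connected U" "U \<subseteq> S1" "U \<noteq> {}" "bad U w0 v"
    then obtain c where "c \<in> \<D>" "U \<inter> c \<noteq> {}" using \<D>(3) by blast
    then show "U \<inter> (\<Union>c\<in>\<D>. E c) \<noteq> {}" using E(2)[OF _ U(1,2)] U(4) by blast
  qed
qed

section \<open>Counting disjoint bad sets\<close>

definition bad_family :: "complex set set \<Rightarrow> 'b \<Rightarrow> bool" where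
  "bad_family \<B> v \<longleftrightarrow> finite \<B> \<and> disjoint \<B> \<and>
    (\<forall>B\<in>\<B>. connected B \<and> B \<subseteq> S1 \<and> B \<noteq> {} \<and> bad B w0 v)"

text \<open>A bound for one \<open>v1\<close> serves all \<open>v\<close>, since some element of
  \<open>pstab w0\<close> moves \<open>v\<close> to \<open>v1\<close>; disjoint bad sets meet the
  finite set of \<open>bad_meets_finite\<close> in distinct points.\<close>

lemma bad_family_bounded:
  obtains N where "\<And>\<B> v. v \<in> \<Omega> \<Longrightarrow> bad_family \<B> v \<Longrightarrow> card \<B> \<le> N"
proof -
  obtain v1 where v1: "v1 \<in> \<Omega>" "v1 \<noteq> w0" using third_point[of w0 w0] by auto
  obtain F where F: "finite F" "\<And>U. connected U \<Longrightarrow> U \<subseteq> S1 \<Longrightarrow> U \<noteq> {} \<Longrightarrow> bad U w0 v1 \<Longrightarrow> U \<inter> F \<noteq> {}"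
    using bad_meets_finite[OF v1] by blast
  have "card \<B> \<le> card F" if v: "v \<in> \<Omega>" and \<B>: "bad_family \<B> v" for \<B> v
  proof (cases "v = w0")
    case True
    then have "\<B> = {}" using \<B> bad_irrefl unfolding bad_family_def by blast
    then show ?thesis by simp
  next
    case False
    obtain h where h: "h \<in> G" "act h w0 = w0" "act h v = v1"
      using transitive2[of w0 v w0 v1] v v1 False by (metis w0)
    have "h ` B \<inter> F \<noteq> {}" if "B \<in> \<B>" for B
    proof -
      have B: "connected B" "B \<subseteq> S1" "B \<noteq> {}" "bad B w0 v" using \<B> that by (auto simp: bad_family_def)
      then have "bad (h ` B) w0 v1" using bad_image[OF h(1) w0 v, of B] h by simp
      then show ?thesis
        using F(2)[of "h ` B"] B connected_image[OF h(1) B(2,1)] image_subset_S1[OF h(1) B(2)] by blast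
    qed
    then have "\<forall>B\<in>\<B>. \<exists>z. z \<in> h ` B \<inter> F" by blast
    then obtain f where f: "\<And>B. B \<in> \<B> \<Longrightarrow> f B \<in> h ` B \<inter> F" by metis
    have "inj_on f \<B>"
    proof (rule inj_onI)
      fix B C assume BC: "B \<in> \<B>" "C \<in> \<B>" "f B = f C"
      then have "f B \<in> h ` (B \<inter> C)" using f[of B] f[of C] image_Int_G[OF h(1), of B C] by auto
      then have "B \<inter> C \<noteq> {}" by blast
      then show "B = C" using \<B> BC unfolding bad_family_def disjoint_def by blast
    qed
    then show ?thesis using F(1) f by (intro card_inj_on_le[of f]) auto
  qed
  then show ?thesis using that by blast
qed

text \<open>The factors of a product of elements with disjoint supports commute, so the product inherits
  the bad sets of each factor.\<close>
lemma bad_family_unbounded: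
  "\<exists>C c \<B>. narrow C \<and> c \<in> rist C \<and> bad_family \<B> (act c w0) \<and> \<Union>\<B> \<subseteq> C \<and> card \<B> = m"
proof (induction m)
  case 0
  have "narrow {}" using narrow_carc[of 0 0] by (simp add: carc_def)
  moreover have "bad_family {} (act id w0)" by (simp add: bad_family_def)
  ultimately show ?case using rist_id[of "{}"] by (metis Union_empty card.empty subset_refl)
next
  case (Suc m)
  then obtain C c \<B> where C: "narrow C" "c \<in> rist C" "bad_family \<B> (act c w0)" "\<Union>\<B> \<subseteq> C" "card \<B> = m"
    by blast
  define K where "K = carc 0 1"
  have K: "narrow K" "open_S1 K" "K \<noteq> {}" "connected K" "K \<subseteq> S1"
    unfolding K_def using pi_gt3 narrow_carc[of 1 0] open_carc[of 1 0] carc_nonempty[of 0 1]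
      connected_carc carc_subset_S1 by auto
  obtain s d where sd: "s \<in> rist K" "s \<in> pstab w0" "d \<in> rist K" "d \<circ> s \<circ> inv d \<notin> pstab w0"
    using not_normalized[OF K(2,3)] by blast
  have dG: "d \<in> G" "s \<in> G" using sd rist_G by auto
  \<comment> \<open>\<open>s\<close> fixes \<open>w0\<close> but not \<open>act c0 w0\<close>,
    because its conjugate by \<open>d\<close> does not fix \<open>w0\<close>.\<close>
  define c0 where "c0 = inv d"
  have c0: "c0 \<in> rist K" "c0 \<in> G" unfolding c0_def using sd dG rist_inv by auto
  have "act s (act c0 w0) \<noteq> act c0 w0"
  proof
    assume "act s (act c0 w0) = act c0 w0"
    then have "act (d \<circ> s \<circ> inv d) w0 = w0" using dG by (simp add: c0_def act_comp)
    then show False using sd(4) dG by (simp add: pstab_def)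
  qed
  then have bad_K: "bad K w0 (act c0 w0)"
    unfolding bad_def using sd(1) pstab_act[OF sd(2)] by blast
  define J1 J2 where J: "J1 = carc 0 1" "J2 = carc 2 3"
  have J_open: "open_S1 J1" "open_S1 J2" "J1 \<noteq> {}" "J2 \<noteq> {}"
    unfolding J using pi_gt3 by (auto intro!: open_carc carc_nonempty)
  have J_disj: "J1 \<inter> J2 = {}" unfolding J using pi_gt3 by (intro carc_disjoint) auto
  \<comment> \<open>Compressing by elements of \<open>pstab w0\<close> preserves badness relative to
    \<open>w0\<close> while the two supports become disjoint.\<close>
  obtain h1 where h1: "h1 \<in> pstab w0" "h1 ` C \<subseteq> J1" using pstab_compress[OF C(1) J_open(1,3)] by blast
  obtain h2 where h2: "h2 \<in> pstab w0" "h2 ` K \<subseteq> J2" using pstab_compress[OF K(1) J_open(2,4)] by blast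
  have hG: "h1 \<in> G" "h2 \<in> G" using h1 h2 pstab_G by auto
  have cG: "c \<in> G" using C rist_G by blast
  have h_inv: "act (inv h1) w0 = w0" "act (inv h2) w0 = w0"
    using act_inv_act[OF hG(1) w0] act_inv_act[OF hG(2) w0] pstab_act[OF h1(1)] pstab_act[OF h2(1)] by simp_all
  define c1 c2 where c12: "c1 = h1 \<circ> c \<circ> inv h1" "c2 = h2 \<circ> c0 \<circ> inv h2"
  have c1: "c1 \<in> rist J1" unfolding c12 using rist_conj[OF hG(1) C(2)] rist_mono h1(2) by blast
  have c2: "c2 \<in> rist J2" unfolding c12 using rist_conj[OF hG(2) c0(1)] rist_mono h2(2) by blast
  have c12G: "c1 \<in> G" "c2 \<in> G" using c1 c2 rist_G by auto
  have act_c: "act h1 (act c w0) = act c1 w0" "act h2 (act c0 w0) = act c2 w0"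
    using hG cG c0(2) h_inv by (simp_all add: c12 act_comp)
  define \<B>' where "\<B>' = insert (h2 ` K) ((`) h1 ` \<B>)"
  have B: "connected B" "B \<subseteq> S1" "B \<noteq> {}" "bad B w0 (act c w0)" "B \<subseteq> C" if "B \<in> \<B>" for B
    using that C(3,4) by (auto simp: bad_family_def)
  have finite: "finite \<B>" and disjoint: "disjoint \<B>" using C(3) by (auto simp: bad_family_def)
  have in_J1: "h1 ` B \<subseteq> J1" if "B \<in> \<B>" for B using B(5)[OF that] h1(2) by blast
  have bad1: "bad (h1 ` B) w0 (act (c1 \<circ> c2) w0)" if "B \<in> \<B>" for B
  proof -
    have "bad (h1 ` B) w0 (act c1 w0)"
      using bad_image[OF hG(1) w0 act_mem[OF cG w0] B(4)[OF that]] pstab_act[OF h1(1)] act_c by simp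
    then have "bad (h1 ` B) w0 (act c2 (act c1 w0))"
      using bad_disjoint_rist[OF c2 _ w0, of "h1 ` B" "act c1 w0"] in_J1[OF that] J_disj c12G by auto
    moreover have "c1 \<circ> c2 = c2 \<circ> c1" using rist_commute[OF c1 c2 J_disj] .
    ultimately show ?thesis using c12G by (simp add: act_comp)
  qed
  have bad2: "bad (h2 ` K) w0 (act (c1 \<circ> c2) w0)"
  proof -
    have "bad (h2 ` K) w0 (act c2 w0)"
      using bad_image[OF hG(2) w0 act_mem[OF c0(2) w0] bad_K] pstab_act[OF h2(1)] act_c by simp
    then have "bad (h2 ` K) w0 (act c1 (act c2 w0))"
      using bad_disjoint_rist[OF c1 _ w0, of "h2 ` K" "act c2 w0"] h2(2) J_disj c12G by auto
    then show ?thesis using c12G by (simp add: act_comp)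
  qed
  have new: "h2 ` K \<inter> h1 ` B = {}" if "B \<in> \<B>" for B using h2(2) in_J1[OF that] J_disj by blast
  have inj: "inj_on ((`) h1) \<B>"
    by (rule inj_onI) (metis hG(1) image_inv_image)
  have notin: "h2 ` K \<notin> (`) h1 ` \<B>" using new K(3) by fastforce
  have "disjoint ((`) h1 ` \<B>)"
    unfolding disjoint_def
  proof (intro ballI impI)
    fix A A' assume "A \<in> (`) h1 ` \<B>" "A' \<in> (`) h1 ` \<B>" "A \<noteq> A'"
    then obtain B B' where "B \<in> \<B>" "B' \<in> \<B>" "A = h1 ` B" "A' = h1 ` B'" "B \<noteq> B'" by blast
    then show "A \<inter> A' = {}" using disjoint image_Int_G[OF hG(1), of B B'] by (auto simp: disjoint_def)
  qed
  then have "disjoint \<B>'"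
    unfolding \<B>'_def pairwise_insert disjnt_def using new by blast
  moreover have "connected B \<and> B \<subseteq> S1 \<and> B \<noteq> {} \<and> bad B w0 (act (c1 \<circ> c2) w0)" if "B \<in> \<B>'" for B
  proof -
    consider "B = h2 ` K" | A where "A \<in> \<B>" "B = h1 ` A" using \<open>B \<in> \<B>'\<close> unfolding \<B>'_def by blast
    then show ?thesis
    proof cases
      case 1
      then show ?thesis
        using bad2 K(3) connected_image[OF hG(2) K(5,4)] image_subset_S1[OF hG(2) K(5)] by blast
    next
      case (2 A)
      then show ?thesis
        using bad1 B[OF 2(1)] connected_image[OF hG(1), of A] image_subset_S1[OF hG(1), of A] by blast
    qed
  qed
  ultimately have "bad_family \<B>' (act (c1 \<circ> c2) w0)"
    using finite by (simp add: bad_family_def \<B>'_def)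
  moreover have "card \<B>' = Suc m"
    unfolding \<B>'_def using finite notin card_image[OF inj] C(5) by simp
  moreover have "narrow (J1 \<union> J2)"
  proof -
    have "J1 \<union> J2 \<subseteq> carc 0 3" unfolding J using carc_mono[of 0 0 1 3] carc_mono[of 0 2 3 3] by auto
    then show ?thesis using narrow_subset[OF narrow_carc[of 3 0]] pi_gt3 by auto
  qed
  moreover have "c1 \<circ> c2 \<in> rist (J1 \<union> J2)" using c1 c2 rist_mono by (intro rist_comp) blast+
  moreover have "\<Union>\<B>' \<subseteq> J1 \<union> J2" unfolding \<B>'_def using in_J1 h2(2) by blast
  ultimately show ?case by blast
qed

lemma contradiction: False
proof -
  obtain N where N: "\<And>\<B> v. v \<in> \<Omega> \<Longrightarrow> bad_family \<B> v \<Longrightarrow> card \<B> \<le> N"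
    using bad_family_bounded by blast
  obtain C c \<B> where "c \<in> rist C" "bad_family \<B> (act c w0)" "card \<B> = Suc N"
    using bad_family_unbounded[of "Suc N"] by blast
  then show False using N[of "act c w0" \<B>] rist_G by force
qed

end

theorem (in triple_action) conjugate_to_orbit:
  "\<exists>z\<in>S1. conjugate_to_circle_set G \<Omega> act (orbit G z)"
proof (rule ccontr)
  assume contra: "\<not> ?thesis"
  obtain f where "f \<in> G" "f \<noteq> id" using not_free unfolding topologically_free_def by blast
  then obtain w0 where w0: "w0 \<in> \<Omega>" using faithful unfolding faithful_action_def by blast
  interpret H: homeo_group "pstab w0" by (rule homeo_group_pstab) (rule w0)
  have "\<exists>h\<in>pstab w0. h x \<in> V" if x: "x \<in> S1" and V: "open_S1 V" "V \<noteq> {}" for x V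
  proof (rule ccontr)
    assume neg: "\<not> ?thesis"
    \<comment> \<open>The saturation of \<open>V\<close> under the stabilizer; its complement
      contains \<open>x\<close> and is an invariant closed set to which
      \<open>invariant_closed_conjugate\<close> applies.\<close>
    define W where "W = (\<Union>h\<in>pstab w0. h ` V)"
    have "open_S1 W" unfolding W_def using V(1) by (intro openin_Union) (auto intro: H.open_image)
    then have "closed (S1 - W)" by (meson closed_sphere closedin_closed_trans closedin_diff closedin_topspace
        closed_subset order_refl)
    moreover have "id ` V \<subseteq> W" unfolding W_def using H.id_mem by blast
    then have "V \<subseteq> W" by simp
    then have "S1 - W \<noteq> S1" using V openin_imp_subset by blast
    moreover have "x \<notin> h ` V" if "h \<in> pstab w0" for h
      using neg that H.mem_image_inv[OF that] H.inv_mem[OF that] by blast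
    then have "S1 - W \<noteq> {}" using x unfolding W_def by blast
    moreover have "h ` (S1 - W) \<subseteq> S1 - W" if h: "h \<in> pstab w0" for h
    proof
      fix y assume "y \<in> h ` (S1 - W)"
      then obtain z where z: "y = h z" "z \<in> S1" "z \<notin> W" by blast
      have "y \<notin> W"
      proof
        assume "y \<in> W"
        then obtain k where k: "k \<in> pstab w0" "y \<in> k ` V" unfolding W_def by blast
        then have "inv h y \<in> (inv h \<circ> k) ` V" by auto
        moreover have "inv h \<circ> k \<in> pstab w0" using h k by simp
        ultimately have "inv h y \<in> W" unfolding W_def by blast
        then show False using z h by simp
      qed
      then show "y \<in> S1 - W" using z H.mem_S1_iff[OF h] by simp
    qed
    ultimately show False using invariant_closed_conjugate[OF w0, of "S1 - W"] contra by blast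
  qed
  then interpret minimal_stabilizer G \<Omega> act w0
    using w0 by unfold_locales
  show False by (rule contradiction)
qed

theorem theorem1p1:
  fixes G :: "(complex \<Rightarrow> complex) set"
  assumes "homeo_subgroup G"
    and "minimal_action G"
    and "proximal_action G"
    and "\<not> topologically_free G"
    and "inj_on (stab (Gplus G)) S1"
  shows "\<forall>(\<Omega> :: 'b set) act. is_action G \<Omega> act \<and> faithful_action G \<Omega> act \<and> three_transitive G \<Omega> act
           \<longrightarrow> (\<exists>x\<in>S1. conjugate_to_circle_set G \<Omega> act (orbit G x))"
proof (intro allI impI)
  fix \<Omega> :: "'b set" and act
  assume "is_action G \<Omega> act \<and> faithful_action G \<Omega> act \<and> three_transitive G \<Omega> act"
  then interpret triple_action G \<Omega> act
    using assms by unfold_locales auto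
  show "\<exists>x\<in>S1. conjugate_to_circle_set G \<Omega> act (orbit G x)"
    by (rule conjugate_to_orbit)
qed

end
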